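(* Let $Q$ be a Dynkin quiver of type $X\in\{A_n,D_n\,(n\ge4),E_6,E_7,E_8\}$ with vertices $v_1,\dots,v_n$ (numbered and alternatingly oriented as described in the context), let $h$ be its Coxeter number, and let $\Sigma_0=(\mathbf x,Q\boxtimes A_\infty)$ be the initial seed of the Hernandez-Leclerc cluster algebra. Let $m\ge h/2+1$ and $l_1,\dots,l_n\ge h/2$ be integers, and let $\mathbf C_X(l_1,\dots,l_n;m)=\{[l_i,r_i]\mid i=1,\dots,n\}$, where the right endpoints $r_i$ are: - $X=A_n$: $r_i=m+\lfloor i/2\rfloor+1$ for $i=1,\dots,n$; - $X=D_n$, $n$ even: $r_i=m+\lfloor i/2\rfloor+1$ for $i=1,\dots,n-2$ and $r_{n-1}=r_n=m+n/2-1$; - $X=D_n$, $n$ odd: $r_i=m+\lfloor i/2\rfloor+1$ for $i=1,\dots,n-2$ and $r_{n-1}=r_n=m+(n-1)/2$; - $X=E_6$: $r_1=m$, $r_2=r_3=r_4=m+1$, $r_5=r_6=m+2$; - $X=E_7$: $r_1=m$, $r_2=r_3=r_4=m+1$, $r_5=r_6=m+2$, $r_7=m+3$; - $X=E_8$: $r_1=m$, $r_2=r_3=r_4=m+1$, $r_5=r_6=m+2$, $r_7=r_8=m+3$. Assume that all the intervals $[l_i,r_i]$ are non-empty. Then there exists a green sequence of mutations $\mathcal S_{\mathbf C}$ such that the $q$-characters of the Kirillov-Reshetikhin modules $W^{(v_i)}_{r_i-l_i+1,\,r_i}$, $i=1,\dots,n$ (the modules whose dominant monomials have support $[l_i,r_i]$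 at the node $v_i$), correspond to cluster variables of the single seed $\Sigma_0\mathcal S_{\mathbf C}$.
   Context: Numbering and orientation of $Q$ (we write $i$ for $v_i$). $A_n$: the chain $1,2,\dots,n$ with even vertices sources and odd vertices sinks ($1\leftarrow2\to3\leftarrow4\to\cdots$). $D_n$: the chain $1\leftarrow2\to3\leftarrow\cdots$ on $1,\dots,n-2$ (even vertices sources), with $n-1$ and $n$ both joined to $n-2$ and oriented so that every vertex is a source or a sink. $E_6$: $1\leftarrow3\to4\leftarrow5\to6$ and $2\to4$. $E_7$: the same together with $7\to6$. $E_8$: the same as $E_7$ together with $7\to8$. Coxeter numbers: $h=n+1$ ($A_n$), $2n-2$ ($D_n$), $12,18,30$ ($E_6,E_7,E_8$). Quivers have no loops or oriented 2-cycles. A seed is a pair $(\mathbf x,R)$ of a quiver $R$ and variables $\mathbf x=(x_u)_{u\in V_R}$. Mutation $\mu_v$ mutates the quiver as usual (for each path $u\to v\to w$ add an arrow $u\to w$; reverse all arrows at $v$; cancel oriented 2-cycles) and replaces $x_v$ by $\big(\prod_{u\to v}x_u+\prod_{v\to w}x_w\big)/x_v$. $\Sigma\mathcal S$ is the result of applying the sequence $\mathcal S$ from left to right. The framed quiver $\overline R$ is $R$ with an added frozen vertex $\bar v$ and an arrow $v\to\bar v$ for each vertex $v$. A mutable vertex of a quiver mutation-equivalent to $\overline R$ is green if no arrow goes from an added frozen vertex to it; a sequence $(w_1,\dots,w_s)$ is green if each $w_j$ is green in $\overline R(w_1,\dots,w_{j-1})$. $A_\infty$ has vertices $1,2,3,\dots$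 and arrows $i+1\to i$. The triangular product $Q\boxtimes R$ has vertex set $V_Q\times V_R$ and arrows: $(u,r)\to(u',r)$ for each arrow $u\to u'$ of $Q$ and $r\in V_R$; $(u,r)\to(u,r')$ for each $u\in V_Q$ and arrow $r\to r'$ of $R$; and $(u',r')\to(u,r)$ for each pair of arrows $u\to u'$ of $Q$ and $r\to r'$ of $R$. $F$-polynomials and $g$-vectors (relative to $\Sigma_0=(\mathbf x,R)$): $y_v=\prod_{v\to u}x_u/\prod_{w\to v}x_w$. The $F$-polynomial $F$ of a cluster variable $z$ obtained by a mutation sequence is obtained by performing the sequence on $\overline R$ and then setting $x_u=1$ for $u\in V_R$, $x_{\bar u}=y_u$; the $g$-vector is the unique integer vector $g$ with $z=\mathbf x^gF(\mathbf y)$. $e_u$ is the unit vector at $u$, with $e_{(v,0)}=0$. Kirillov-Reshetikhin modules: irreducible finite-dimensional representations $V(M)$ of the untwisted quantum affine algebra $U_q(\hat{\mathfrak g})$ of type $X^{(1)}$ ($q$ not a root of unity) are parameterized by monomials $M=\prod_i\prod_sY_{i,c^{(i)}_s}$, where $V(M)$ has Drinfeld polynomials $P_i(u)=\prod_s(1-c^{(i)}_su)$. Put $t_{v,k}=Y_{v,q^{-2k+2}}$ if $v$ is a source and $t_{v,k}=Y_{v,q^{-2k+1}}$ if $v$ is a sink. $W^{(v)}_{k,d+k}=V\big(\prod_{j=1}^kt_{v,d+j}\big)$, with support $[d+1,d+k]$. $\chi_q$ is the Frenkel-Reshetikhin $q$-character. Correspondence: the cluster variable corresponding to (the $q$-character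 of) $W^{(v)}_{k,d+k}$ is the one with $g$-vector $e_{(v,d+k)}-e_{(v,d)}$. By results of Hernandez and Leclerc, after the change of variables $t_{v,1}=x_{(v,1)}$, $t_{v,k}=x_{(v,k)}/x_{(v,k-1)}$ ($k\ge2$) it becomes $\chi_q(W^{(v)}_{k,d+k})$ if $d\ge h/2$, and the truncated $q$-character if $d<h/2$ (the truncated $q$-character is obtained by writing $\chi_q$ as its highest weight monomial times a polynomial in the $y_{(u,j)}$, $j\in\mathbb Z$, expressed in the variables $t$ extended to all integer indices, and setting $y_{(u,j)}=0$ for $j\le0$). *)

theory Defs
  imports
    Complex_Main
    "HOL-Library.Multiset"
    "HOL-Library.Poly_Mapping"
    "HOL-Library.Product_Lexorder"
    "HOL-Computational_Algebra.Fraction_Field"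
begin

section \<open>Quivers and mutation\<close>

text \<open>\<open>arrows R u v\<close> is the number of arrows \<open>u \<rightarrow> v\<close>. All quivers below are locally finite
  and have no loops, no oriented 2-cycles and no arrows outside \<open>qverts\<close>; mutation preserves this.\<close>

record 'v quiver =
  qverts :: "'v set"
  arrows :: "'v \<Rightarrow> 'v \<Rightarrow> nat"

text \<open>Away from \<open>v\<close>, the truncated subtraction cancels the oriented 2-cycles created by the new
  arrows \<open>u \<rightarrow> w\<close>, one for each path \<open>u \<rightarrow> v \<rightarrow> w\<close>.\<close>

definition mutate_quiver :: "'v \<Rightarrow> 'v quiver \<Rightarrow> 'v quiver" where
  "mutate_quiver v R =
     \<lparr> qverts = qverts R,
       arrows = (\<lambda>u w.
         if u = v \<or> w = v then arrows R w u
         else (arrows R u w + arrows R u v * arrows R v w)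
            - (arrows R w u + arrows R w v * arrows R v u)) \<rparr>"

type_synonym ('v, 'k) seed = "'v quiver \<times> ('v \<Rightarrow> 'k)"

definition mutate_seed :: "'v \<Rightarrow> ('v, 'k::field) seed \<Rightarrow> ('v, 'k) seed" where
  "mutate_seed v \<Sigma> = (case \<Sigma> of (R, x) \<Rightarrow>
     (mutate_quiver v R,
      x(v := ((\<Prod>u\<in>{u. arrows R u v > 0}. x u ^ arrows R u v)
            + (\<Prod>w\<in>{w. arrows R v w > 0}. x w ^ arrows R v w)) / x v)))"

text \<open>Sequences of mutations are applied from left to right.\<close>

definition mutate_seed_seq :: "'v list \<Rightarrow> ('v, 'k::field) seed \<Rightarrow> ('v, 'k) seed" where
  "mutate_seed_seq ws \<Sigma> = fold mutate_seed ws \<Sigma>"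

definition mutate_quiver_seq :: "'v list \<Rightarrow> 'v quiver \<Rightarrow> 'v quiver" where
  "mutate_quiver_seq ws R = fold mutate_quiver ws R"

section \<open>Framed quivers and green sequences\<close>

datatype 'v framed_vertex = Mutable 'v | Frozen 'v

text \<open>A linear order is needed only because the library makes polynomials in variables indexed by
  \<open>'v\<close> an integral domain only for linearly ordered \<open>'v\<close>. The same holds for the lexicographic order
  on pairs.\<close>

instantiation framed_vertex :: (linorder) linorder
begin

fun less_eq_framed_vertex :: "'a framed_vertex \<Rightarrow> 'a framed_vertex \<Rightarrow> bool" where
  "less_eq_framed_vertex (Mutable u) (Mutable v) = (u \<le> v)"
| "less_eq_framed_vertex (Mutable u) (Frozen v) = True"
| "less_eq_framed_vertex (Frozen u) (Mutable v) = False"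
| "less_eq_framed_vertex (Frozen u) (Frozen v) = (u \<le> v)"

definition less_framed_vertex :: "'a framed_vertex \<Rightarrow> 'a framed_vertex \<Rightarrow> bool" where
  "less_framed_vertex a b \<longleftrightarrow> a \<le> b \<and> \<not> b \<le> a"

instance
proof
  fix a b c :: "'a framed_vertex"
  show "a < b \<longleftrightarrow> a \<le> b \<and> \<not> b \<le> a" by (rule less_framed_vertex_def)
  show "a \<le> a" by (cases a) auto
  show "a \<le> b \<Longrightarrow> b \<le> c \<Longrightarrow> a \<le> c" by (cases a; cases b; cases c) auto
  show "a \<le> b \<Longrightarrow> b \<le> a \<Longrightarrow> a = b" by (cases a; cases b) auto
  show "a \<le> b \<or> b \<le> a" by (cases a; cases b) auto
qed

end

definition framed_quiver :: "'v quiver \<Rightarrow> 'v framed_vertex quiver" where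
  "framed_quiver R =
     \<lparr> qverts = Mutable ` qverts R \<union> Frozen ` qverts R,
       arrows = (\<lambda>a b. case (a, b) of
           (Mutable u, Mutable v) \<Rightarrow> arrows R u v
         | (Mutable u, Frozen v) \<Rightarrow> (if u = v \<and> u \<in> qverts R then 1 else 0)
         | _ \<Rightarrow> 0) \<rparr>"

definition green_vertex :: "'v framed_vertex quiver \<Rightarrow> 'v \<Rightarrow> bool" where
  "green_vertex R' v \<longleftrightarrow> (\<forall>w. arrows R' (Frozen w) (Mutable v) = 0)"

definition green_sequence :: "'v quiver \<Rightarrow> 'v list \<Rightarrow> bool" where
  "green_sequence R ws \<longleftrightarrow>
     set ws \<subseteq> qverts R \<and>
     (\<forall>j<length ws. green_vertex
        (mutate_quiver_seq (map Mutable (take j ws)) (framed_quiver R)) (ws ! j))"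

section \<open>Rational functions, F-polynomials and g-vectors\<close>

text \<open>The field of rational functions in variables indexed by \<open>'v\<close>, as the fraction field of the
  polynomial ring with integer coefficients.\<close>

type_synonym 'v ratfun = "(('v \<Rightarrow>\<^sub>0 nat) \<Rightarrow>\<^sub>0 int) fract"

definition Var :: "'v::linorder \<Rightarrow> 'v ratfun" where
  "Var v = Fract (Poly_Mapping.single (Poly_Mapping.single v 1) 1) 1"

definition eval_poly :: "('v \<Rightarrow> 'k::field) \<Rightarrow> (('v \<Rightarrow>\<^sub>0 nat) \<Rightarrow>\<^sub>0 int) \<Rightarrow> 'k" where
  "eval_poly \<sigma> p =
     (\<Sum>m\<in>Poly_Mapping.keys p. of_int (Poly_Mapping.lookup p m) *
        (\<Prod>v\<in>Poly_Mapping.keys m. \<sigma> v ^ Poly_Mapping.lookup m v))"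

text \<open>Substitution of \<open>\<sigma> v\<close> for each variable \<open>v\<close>: the value does not depend on the representation
  as a fraction, as long as the denominator does not vanish after the substitution.\<close>

definition substitute :: "('v::linorder \<Rightarrow> 'k::field) \<Rightarrow> 'v ratfun \<Rightarrow> 'k" where
  "substitute \<sigma> f = (THE c. \<exists>p q. f = Fract p q \<and> q \<noteq> 0 \<and> eval_poly \<sigma> q \<noteq> 0 \<and>
     c = eval_poly \<sigma> p / eval_poly \<sigma> q)"

text \<open>In the remainder of this section the variables are relative to the initial seed \<open>(Var, R)\<close>.\<close>

definition initial_seed :: "'v::linorder quiver \<Rightarrow> ('v, 'v ratfun) seed" where
  "initial_seed R = (R, Var)"

definition cluster_variable :: "'v::linorder quiver \<Rightarrow> 'v list \<Rightarrow> 'v \<Rightarrow> 'v ratfun" where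
  "cluster_variable R ws u = snd (mutate_seed_seq ws (initial_seed R)) u"

text \<open>The F-polynomial is expressed in variables \<open>Var v\<close> standing for the indeterminates \<open>y\<^sub>v\<close>.\<close>

definition F_polynomial :: "'v::linorder quiver \<Rightarrow> 'v list \<Rightarrow> 'v \<Rightarrow> 'v ratfun" where
  "F_polynomial R ws u =
     substitute (case_framed_vertex (\<lambda>v. 1) Var)
       (cluster_variable (framed_quiver R) (map Mutable ws) (Mutable u))"

definition y_var :: "'v::linorder quiver \<Rightarrow> 'v \<Rightarrow> 'v ratfun" where
  "y_var R v = (\<Prod>u\<in>{u. arrows R v u > 0}. Var u ^ arrows R v u)
             / (\<Prod>w\<in>{w. arrows R w v > 0}. Var w ^ arrows R w v)"

text \<open>\<open>g\<close> is the g-vector of the cluster variable at \<open>u\<close> in the seed obtained by the sequence \<open>ws\<close>.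
  There is at most one such \<open>g\<close>, since distinct Laurent monomials are distinct.\<close>

definition is_g_vector :: "'v::linorder quiver \<Rightarrow> 'v list \<Rightarrow> 'v \<Rightarrow> ('v \<Rightarrow> int) \<Rightarrow> bool" where
  "is_g_vector R ws u g \<longleftrightarrow>
     finite {v. g v \<noteq> 0} \<and> {v. g v \<noteq> 0} \<subseteq> qverts R \<and>
     cluster_variable R ws u =
       (\<Prod>v\<in>{v. g v \<noteq> 0}. Var v powi g v) * substitute (y_var R) (F_polynomial R ws u)"

section \<open>Dynkin quivers, the triangular product and the Hernandez--Leclerc quiver\<close>

datatype dynkin_type = A nat | D nat | E6 | E7 | E8

fun valid_type :: "dynkin_type \<Rightarrow> bool" where
  "valid_type (A n) = (n \<ge> 1)"
| "valid_type (D n) = (n \<ge> 4)"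
| "valid_type _ = True"

fun type_rank :: "dynkin_type \<Rightarrow> nat" where
  "type_rank (A n) = n"
| "type_rank (D n) = n"
| "type_rank E6 = 6"
| "type_rank E7 = 7"
| "type_rank E8 = 8"

fun coxeter_number :: "dynkin_type \<Rightarrow> nat" where
  "coxeter_number (A n) = n + 1"
| "coxeter_number (D n) = 2 * n - 2"
| "coxeter_number E6 = 12"
| "coxeter_number E7 = 18"
| "coxeter_number E8 = 30"

text \<open>The chain on \<open>1, \<dots>, n\<close> whose even vertices are sources and whose odd vertices are sinks.\<close>

definition chain_arrows :: "nat \<Rightarrow> (nat \<times> nat) set" where
  "chain_arrows n =
     {(i, j). i \<in> {1..n} \<and> j \<in> {1..n} \<and> even i \<and> (j = i + 1 \<or> i = j + 1)}"

fun dynkin_arrows :: "dynkin_type \<Rightarrow> (nat \<times> nat) set" where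
  "dynkin_arrows (A n) = chain_arrows n"
| "dynkin_arrows (D n) = chain_arrows (n - 2) \<union>
     (if even n then {(n - 2, n - 1), (n - 2, n)} else {(n - 1, n - 2), (n, n - 2)})"
| "dynkin_arrows E6 = {(3, 1), (3, 4), (5, 4), (5, 6), (2, 4)}"
| "dynkin_arrows E7 = {(3, 1), (3, 4), (5, 4), (5, 6), (2, 4), (7, 6)}"
| "dynkin_arrows E8 = {(3, 1), (3, 4), (5, 4), (5, 6), (2, 4), (7, 6), (7, 8)}"

definition dynkin_quiver :: "dynkin_type \<Rightarrow> nat quiver" where
  "dynkin_quiver X =
     \<lparr> qverts = {1..type_rank X}, arrows = (\<lambda>i j. of_bool ((i, j) \<in> dynkin_arrows X)) \<rparr>"

definition A_infinity :: "nat quiver" where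
  "A_infinity = \<lparr> qverts = {1..}, arrows = (\<lambda>i j. of_bool (j \<ge> 1 \<and> i = j + 1)) \<rparr>"

definition triangular_product :: "'a quiver \<Rightarrow> 'b quiver \<Rightarrow> ('a \<times> 'b) quiver"
    (infixl \<open>\<boxtimes>\<close> 70) where
  "Q \<boxtimes> R =
     \<lparr> qverts = qverts Q \<times> qverts R,
       arrows = (\<lambda>(u, r) (u', r').
           (if r = r' \<and> r \<in> qverts R then arrows Q u u' else 0)
         + (if u = u' \<and> u \<in> qverts Q then arrows R r r' else 0)
         + arrows Q u' u * arrows R r' r) \<rparr>"

definition HL_quiver :: "dynkin_type \<Rightarrow> (nat \<times> nat) quiver" where
  "HL_quiver X = dynkin_quiver X \<boxtimes> A_infinity"

section \<open>Kirillov--Reshetikhin modules and the correspondence with cluster variables\<close>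

text \<open>The module \<open>V(M)\<close> is represented by the monomial \<open>M\<close> parameterizing it. As \<open>q\<close> is not a root
  of unity, the variable \<open>Y\<^sub>v\<^sub>,\<^sub>c\<close> with \<open>c = q\<^sup>s\<close> is faithfully encoded by the pair \<open>(v, s)\<close>, and a
  monomial by the multiset of its factors.\<close>

type_synonym Y_monomial = "(nat \<times> int) multiset"

text \<open>In type \<open>A\<^sub>1\<close> the only vertex counts as a sink, in accordance with the rule that odd vertices
  of a chain are sinks.\<close>

definition is_source :: "dynkin_type \<Rightarrow> nat \<Rightarrow> bool" where
  "is_source X v \<longleftrightarrow> (\<exists>w. (v, w) \<in> dynkin_arrows X)"

definition t_var :: "dynkin_type \<Rightarrow> nat \<Rightarrow> nat \<Rightarrow> nat \<times> int" where
  "t_var X v k = (v, if is_source X v then - 2 * int k + 2 else - 2 * int k + 1)"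

text \<open>\<open>KR X v k s\<close> is (the highest weight monomial of) \<open>W\<^bsup>(v)\<^esup>\<^bsub>k,s\<^esub>\<close>, where \<open>s = d + k\<close>; its support
  is \<open>[d + 1, d + k]\<close>.\<close>

definition KR :: "dynkin_type \<Rightarrow> nat \<Rightarrow> nat \<Rightarrow> nat \<Rightarrow> Y_monomial" where
  "KR X v k s = image_mset (\<lambda>j. t_var X v (s - k + j)) (mset_set {1..k})"

definition unit_vec :: "nat \<times> nat \<Rightarrow> nat \<times> nat \<Rightarrow> int" where
  "unit_vec u w = (if w = u \<and> snd u \<noteq> 0 then 1 else 0)"

text \<open>The cluster variable at vertex \<open>u\<close> of the seed obtained by the sequence \<open>ws\<close> from the initial
  seed on \<open>HL_quiver X\<close> corresponds to the q-character of the Kirillov--Reshetikhin module \<open>V(M)\<close>.\<close>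

definition corresponds :: "dynkin_type \<Rightarrow> (nat \<times> nat) list \<Rightarrow> nat \<times> nat \<Rightarrow> Y_monomial \<Rightarrow> bool" where
  "corresponds X ws u M \<longleftrightarrow>
     (\<exists>v\<in>{1..type_rank X}. \<exists>d k. k \<ge> 1 \<and> M = KR X v k (d + k) \<and>
        is_g_vector (HL_quiver X) ws u (\<lambda>w. unit_vec (v, d + k) w - unit_vec (v, d) w))"

section \<open>The right endpoints\<close>

fun right_endpoint :: "dynkin_type \<Rightarrow> nat \<Rightarrow> nat \<Rightarrow> nat" where
  "right_endpoint (A n) m i = m + i div 2 + 1"
| "right_endpoint (D n) m i =
     (if i \<le> n - 2 then m + i div 2 + 1
      else if even n then m + n div 2 - 1
      else m + (n - 1) div 2)"
| "right_endpoint E6 m i =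
     (if i = 1 then m else if i \<le> 4 then m + 1 else m + 2)"
| "right_endpoint E7 m i =
     (if i = 1 then m else if i \<le> 4 then m + 1 else if i \<le> 6 then m + 2 else m + 3)"
| "right_endpoint E8 m i =
     (if i = 1 then m else if i \<le> 4 then m + 1 else if i \<le> 6 then m + 2 else m + 3)"

end

theory Submission
  imports Defs
begin

text \<open>The T-system relations of Kirillov--Reshetikhin modules are exchange relations. Mutating the
  source columns and then the sink columns of \<open>Q \<boxtimes> A\<^sub>\<infinity>\<close>, each from the bottom up, moves the supports
  at all mutated vertices by one. Stopping each column early enough that no support passes \<open>r\<^sub>i\<close>,
  and repeating, leaves the support \<open>[r\<^sub>i - p + 1, r\<^sub>i]\<close> at \<open>(i, p)\<close> for every \<open>p \<le> r\<^sub>i\<close>. The right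
  endpoints only have to satisfy \<open>r\<^sub>j \<le> r\<^sub>i \<le> r\<^sub>j + 1\<close> for every arrow \<open>i \<rightarrow> j\<close> of \<open>Q\<close>, for then the
  neighbouring factors of each T-system relation are present when it is needed.

  Along a green sequence the c-vectors and the g-vectors change by inverse transpose base changes.
  Hence the c-vector of the vertex to be mutated, which is the indicator of its support, can be read
  off from the g-vectors, and so can the arrows at that vertex. In particular it is nonnegative, so
  the sequence is green.\<close>

section \<open>Subtraction-free rational functions\<close>

definition eval_monomial :: "('v \<Rightarrow> 'k::comm_monoid_mult) \<Rightarrow> ('v \<Rightarrow>\<^sub>0 nat) \<Rightarrow> 'k" where
  "eval_monomial \<sigma> m = (\<Prod>v\<in>Poly_Mapping.keys m. \<sigma> v ^ Poly_Mapping.lookup m v)"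

text \<open>Factors off the support are zeroth powers. Passing to a common finite index set lets two
  exponent vectors be combined factor by factor; the later superset lemmas do the same for sums and
  Laurent monomials.\<close>

lemma eval_monomial_superset:
  assumes "finite S" "Poly_Mapping.keys m \<subseteq> S"
  shows "eval_monomial \<sigma> m = (\<Prod>v\<in>S. \<sigma> v ^ Poly_Mapping.lookup m v)"
  unfolding eval_monomial_def using assms
  by (intro prod.mono_neutral_left) (auto simp: in_keys_iff)

lemma eval_monomial_add: "eval_monomial \<sigma> (m + m') = eval_monomial \<sigma> m * eval_monomial \<sigma> m'"
proof -
  let ?S = "Poly_Mapping.keys m \<union> Poly_Mapping.keys m'"
  have "Poly_Mapping.keys (m + m') \<subseteq> ?S"
    by (rule keys_add)
  then show ?thesis
    by (simp add: eval_monomial_superset[of ?S] lookup_add power_add prod.distrib)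
qed

lemma eval_monomial_single [simp]: "eval_monomial \<sigma> (Poly_Mapping.single v k) = \<sigma> v ^ k"
  by (simp add: eval_monomial_def)

lemma eval_monomial_zero [simp]: "eval_monomial \<sigma> 0 = 1"
  by (simp add: eval_monomial_def)

lemma eval_poly_superset:
  assumes "finite S" "Poly_Mapping.keys p \<subseteq> S"
  shows "eval_poly \<sigma> p = (\<Sum>m\<in>S. of_int (Poly_Mapping.lookup p m) * eval_monomial \<sigma> m)"
  unfolding eval_poly_def eval_monomial_def using assms
  by (intro sum.mono_neutral_left) (auto simp: in_keys_iff)

lemma eval_poly_zero [simp]: "eval_poly \<sigma> 0 = 0"
  by (simp add: eval_poly_def)

lemma eval_poly_add: "eval_poly \<sigma> (p + q) = eval_poly \<sigma> p + eval_poly \<sigma> q"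
proof -
  let ?S = "Poly_Mapping.keys p \<union> Poly_Mapping.keys q"
  have "Poly_Mapping.keys (p + q) \<subseteq> ?S"
    by (rule keys_add)
  then show ?thesis
    by (simp add: eval_poly_superset[of ?S] lookup_add distrib_right sum.distrib)
qed

lemma eval_poly_sum: "eval_poly \<sigma> (sum f I) = (\<Sum>i\<in>I. eval_poly \<sigma> (f i))"
  by (induction I rule: infinite_finite_induct) (auto simp: eval_poly_add)

lemma eval_poly_single [simp]:
  "eval_poly \<sigma> (Poly_Mapping.single m c) = of_int c * eval_monomial \<sigma> m"
  by (subst eval_poly_superset[of "{m}"]) auto

lemma poly_mapping_sum_single:
  "p = (\<Sum>m\<in>Poly_Mapping.keys p. Poly_Mapping.single m (Poly_Mapping.lookup p m))"
  by (rule poly_mapping_eqI)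
     (auto simp: lookup_sum lookup_single when_def not_in_keys_iff_lookup_eq_zero)

text \<open>Expanding into single terms reduces both the multiplicativity of
  \<open>eval_poly\<close> and the sign of product coefficients to one term at a time.\<close>

lemma mult_eq_sum_single:
  fixes p q :: "'a::monoid_add \<Rightarrow>\<^sub>0 'b::semiring_0"
  shows "p * q = (\<Sum>m\<in>Poly_Mapping.keys p. \<Sum>m'\<in>Poly_Mapping.keys q.
    Poly_Mapping.single (m + m') (Poly_Mapping.lookup p m * Poly_Mapping.lookup q m'))"
  by (subst (1) poly_mapping_sum_single[of p], subst (1) poly_mapping_sum_single[of q])
     (simp add: sum_product mult_single)

lemma eval_poly_mult: "eval_poly \<sigma> (p * q) = eval_poly \<sigma> p * eval_poly \<sigma> q"
proof -
  have "eval_poly \<sigma> (p * q) = (\<Sum>m\<in>Poly_Mapping.keys p. \<Sum>m'\<in>Poly_Mapping.keys q.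
      (of_int (Poly_Mapping.lookup p m) * eval_monomial \<sigma> m) *
      (of_int (Poly_Mapping.lookup q m') * eval_monomial \<sigma> m'))"
    by (subst mult_eq_sum_single) (simp add: eval_poly_sum eval_monomial_add mult_ac)
  then show ?thesis
    by (simp add: sum_product eval_poly_superset[OF finite_keys subset_refl])
qed

section \<open>Polynomials and fractions with nonnegative coefficients\<close>

definition positive_poly :: "('m \<Rightarrow>\<^sub>0 int) \<Rightarrow> bool" where
  "positive_poly p \<longleftrightarrow> p \<noteq> 0 \<and> (\<forall>m. Poly_Mapping.lookup p m \<ge> 0)"

lemma positive_poly_add:
  assumes "positive_poly p" "positive_poly q"
  shows "positive_poly (p + q)"
proof -
  \<comment> \<open>Nonnegative coefficients cannot cancel, so a positive one of \<open>p\<close>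
    survives in the sum.\<close>
  obtain m where "Poly_Mapping.lookup p m > 0"
    using assms(1) unfolding positive_poly_def
    by (metis order_le_less poly_mapping_eqI lookup_zero)
  then have "Poly_Mapping.lookup (p + q) m \<noteq> 0"
    using assms(2) unfolding positive_poly_def lookup_add by (smt (verit))
  then have "p + q \<noteq> 0"
    by force
  then show ?thesis
    using assms unfolding positive_poly_def by (auto simp: lookup_add)
qed

text \<open>Signs are checked termwise; nonvanishing is the integral domain property, which is where
  the linear order on the variables enters.\<close>

lemma positive_poly_mult:
  fixes p q :: "('v::linorder \<Rightarrow>\<^sub>0 nat) \<Rightarrow>\<^sub>0 int"
  assumes "positive_poly p" "positive_poly q"
  shows "positive_poly (p * q)"
proof -
  have "Poly_Mapping.lookup (p * q) m \<ge> 0" for m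
    using assms by (subst mult_eq_sum_single)
      (auto simp: positive_poly_def lookup_sum lookup_single when_def intro!: sum_nonneg)
  then show ?thesis
    using assms by (auto simp: positive_poly_def)
qed

text \<open>\<open>substitute\<close> is compatible with the field operations only as long as no denominator vanishes.
  Subtraction-free fractions avoid this problem: they are nonzero, and they stay so when
  subtraction-free fractions are substituted for the variables.\<close>

definition subtraction_free :: "'v::linorder ratfun \<Rightarrow> bool" where
  "subtraction_free f \<longleftrightarrow> (\<exists>p q. f = Fract p q \<and> positive_poly p \<and> positive_poly q)"

lemma subtraction_free_nonzero: "subtraction_free f \<Longrightarrow> f \<noteq> 0"
  by (auto simp: subtraction_free_def positive_poly_def Zero_fract_def eq_fract)

lemma positive_poly_one: "positive_poly (1 :: ('v::linorder \<Rightarrow>\<^sub>0 nat) \<Rightarrow>\<^sub>0 int)"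
  by (auto simp: positive_poly_def lookup_one when_def)

lemma subtraction_free_one [simp]: "subtraction_free 1"
  unfolding subtraction_free_def using positive_poly_one by (metis One_fract_def)

lemma subtraction_free_Var [simp]:
  fixes v :: "'v::linorder"
  shows "subtraction_free (Var v)"
proof -
  have "positive_poly (Poly_Mapping.single (Poly_Mapping.single v 1) 1 :: ('v \<Rightarrow>\<^sub>0 nat) \<Rightarrow>\<^sub>0 int)"
    by (auto simp: positive_poly_def lookup_single when_def)
  then show ?thesis
    unfolding subtraction_free_def Var_def using positive_poly_one by blast
qed

lemma subtraction_free_add:
  assumes "subtraction_free f" "subtraction_free g"
  shows "subtraction_free (f + g)"
proof -
  obtain p q p' q' where *: "f = Fract p q" "g = Fract p' q'"
      "positive_poly p" "positive_poly q" "positive_poly p'" "positive_poly q'"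
    using assms by (auto simp: subtraction_free_def)
  then have "f + g = Fract (p * q' + p' * q) (q * q')"
    by (simp add: positive_poly_def)
  then show ?thesis
    using * unfolding subtraction_free_def
    by (metis positive_poly_add positive_poly_mult)
qed

lemma subtraction_free_mult:
  assumes "subtraction_free f" "subtraction_free g"
  shows "subtraction_free (f * g)"
  using assms unfolding subtraction_free_def by (metis mult_fract positive_poly_mult)

lemma subtraction_free_divide:
  assumes "subtraction_free f" "subtraction_free g"
  shows "subtraction_free (f / g)"
  using assms unfolding subtraction_free_def by (metis divide_fract positive_poly_mult)

lemma subtraction_free_power: "subtraction_free f \<Longrightarrow> subtraction_free (f ^ n)"
  by (induction n) (auto intro: subtraction_free_mult)

lemma subtraction_free_prod:
  "(\<And>i. i \<in> I \<Longrightarrow> subtraction_free (f i)) \<Longrightarrow> subtraction_free (prod f I)"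
  by (induction I rule: infinite_finite_induct) (auto intro: subtraction_free_mult)

lemma subtraction_free_sum:
  "finite I \<Longrightarrow> I \<noteq> {} \<Longrightarrow> (\<And>i. i \<in> I \<Longrightarrow> subtraction_free (f i)) \<Longrightarrow> subtraction_free (sum f I)"
  by (induction I rule: finite_ne_induct) (auto intro: subtraction_free_add)

text \<open>A positive integer is a sum of ones. This handles the coefficients of an evaluated
  polynomial.\<close>

lemma subtraction_free_of_int:
  assumes "n > 0"
  shows "subtraction_free (of_int n)"
proof -
  have "subtraction_free (of_nat (Suc k))" for k
  proof (induction k)
    case (Suc k)
    then show ?case
      using subtraction_free_add[OF subtraction_free_one Suc] by simp
  qed simp
  moreover have "of_int n = of_nat (Suc (nat n - 1))"
    using assms by simp
  ultimately show ?thesis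
    by metis
qed

lemma subtraction_free_eval_poly:
  fixes \<sigma> :: "'v \<Rightarrow> 'w::linorder ratfun"
  assumes "\<And>v. subtraction_free (\<sigma> v)" and p: "positive_poly p"
  shows "subtraction_free (eval_poly \<sigma> p)"
  unfolding eval_poly_def
proof (intro subtraction_free_sum subtraction_free_mult subtraction_free_prod
    subtraction_free_power subtraction_free_of_int assms)
  show "Poly_Mapping.keys p \<noteq> {}"
    using p by (auto simp: positive_poly_def)
  show "0 < Poly_Mapping.lookup p m" if "m \<in> Poly_Mapping.keys p" for m
    using p that by (auto simp: positive_poly_def in_keys_iff order_le_less)
qed auto

section \<open>Substitution as a homomorphism on subtraction-free fractions\<close>

lemma substitute_Fract:
  assumes "q \<noteq> 0" "eval_poly \<sigma> q \<noteq> 0"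
  shows "substitute \<sigma> (Fract p q) = eval_poly \<sigma> p / eval_poly \<sigma> q"
  unfolding substitute_def
proof (rule the_equality)
  fix c
  assume "\<exists>p' q'. Fract p q = Fract p' q' \<and> q' \<noteq> 0 \<and> eval_poly \<sigma> q' \<noteq> 0 \<and>
      c = eval_poly \<sigma> p' / eval_poly \<sigma> q'"
  then obtain p' q' where *: "Fract p q = Fract p' q'" "q' \<noteq> 0" "eval_poly \<sigma> q' \<noteq> 0"
      "c = eval_poly \<sigma> p' / eval_poly \<sigma> q'"
    by blast
  \<comment> \<open>Two representations agree after cross-multiplication, which
    \<open>eval_poly\<close> preserves, so the described value is unique.\<close>
  then have "p * q' = p' * q"
    using assms by (simp add: eq_fract)
  then have "eval_poly \<sigma> p * eval_poly \<sigma> q' = eval_poly \<sigma> p' * eval_poly \<sigma> q"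
    by (metis eval_poly_mult)
  then show "c = eval_poly \<sigma> p / eval_poly \<sigma> q"
    using * assms by (simp add: frac_eq_eq)
qed (use assms in blast)

locale subtraction_free_substitution =
  fixes \<sigma> :: "'v::linorder \<Rightarrow> 'w::linorder ratfun"
  assumes \<sigma>: "subtraction_free (\<sigma> v)"
begin

lemma substitute_positive:
  assumes "positive_poly p" "positive_poly q"
  shows "substitute \<sigma> (Fract p q) = eval_poly \<sigma> p / eval_poly \<sigma> q"
    and "eval_poly \<sigma> p \<noteq> 0" and "eval_poly \<sigma> q \<noteq> 0"
proof -
  show *: "eval_poly \<sigma> p \<noteq> 0" "eval_poly \<sigma> q \<noteq> 0"
    using assms \<sigma> by (auto intro!: subtraction_free_nonzero subtraction_free_eval_poly)
  show "substitute \<sigma> (Fract p q) = eval_poly \<sigma> p / eval_poly \<sigma> q"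
    using assms * by (intro substitute_Fract) (auto simp: positive_poly_def)
qed

lemma subtraction_free_substitute:
  assumes "subtraction_free f"
  shows "subtraction_free (substitute \<sigma> f)"
  using assms \<sigma> unfolding subtraction_free_def[of f]
  by (auto simp: substitute_positive intro!: subtraction_free_divide subtraction_free_eval_poly)

lemma substitute_one [simp]: "substitute \<sigma> 1 = 1"
proof -
  have "eval_poly \<sigma> 1 = 1"
    by (simp flip: single_one)
  then have "substitute \<sigma> (Fract 1 1) = 1"
    by (subst substitute_positive) (simp_all add: positive_poly_one)
  then show ?thesis
    by (metis One_fract_def)
qed

lemma substitute_Var [simp]: "substitute \<sigma> (Var v) = \<sigma> v"
  unfolding Var_def
  by (subst substitute_Fract) (auto simp flip: single_one)

lemma substitute_add:
  assumes "subtraction_free f" "subtraction_free g"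
  shows "substitute \<sigma> (f + g) = substitute \<sigma> f + substitute \<sigma> g"
proof -
  obtain p q p' q' where *: "f = Fract p q" "g = Fract p' q'"
      "positive_poly p" "positive_poly q" "positive_poly p'" "positive_poly q'"
    using assms by (auto simp: subtraction_free_def)
  then have "f + g = Fract (p * q' + p' * q) (q * q')"
    by (simp add: positive_poly_def)
  then show ?thesis
    using * by (simp add: substitute_positive positive_poly_add positive_poly_mult
        eval_poly_add eval_poly_mult add_frac_eq)
qed

lemma substitute_mult:
  assumes "subtraction_free f" "subtraction_free g"
  shows "substitute \<sigma> (f * g) = substitute \<sigma> f * substitute \<sigma> g"
  using assms unfolding subtraction_free_def
  by (auto simp: substitute_positive positive_poly_mult eval_poly_mult)

lemma substitute_divide:
  assumes "subtraction_free f" "subtraction_free g"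
  shows "substitute \<sigma> (f / g) = substitute \<sigma> f / substitute \<sigma> g"
  using assms unfolding subtraction_free_def
  by (auto simp: substitute_positive positive_poly_mult eval_poly_mult)

lemma substitute_power:
  "subtraction_free f \<Longrightarrow> substitute \<sigma> (f ^ n) = substitute \<sigma> f ^ n"
  by (induction n) (auto simp: substitute_mult subtraction_free_power)

lemma substitute_prod:
  "(\<And>i. i \<in> I \<Longrightarrow> subtraction_free (f i)) \<Longrightarrow>
    substitute \<sigma> (prod f I) = (\<Prod>i\<in>I. substitute \<sigma> (f i))"
  by (induction I rule: infinite_finite_induct) (auto simp: substitute_mult subtraction_free_prod)

end

section \<open>Green mutations, c-vectors and g-vectors\<close>

definition linear_ext :: "('v \<Rightarrow> int) \<Rightarrow> ('v \<Rightarrow>\<^sub>0 int) \<Rightarrow> int" where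
  "linear_ext f x = (\<Sum>j\<in>Poly_Mapping.keys x. Poly_Mapping.lookup x j * f j)"

lemma linear_ext_superset:
  assumes "finite S" "Poly_Mapping.keys x \<subseteq> S"
  shows "linear_ext f x = (\<Sum>j\<in>S. Poly_Mapping.lookup x j * f j)"
  unfolding linear_ext_def using assms
  by (intro sum.mono_neutral_left) (auto simp: in_keys_iff)

lemma linear_ext_zero [simp]: "linear_ext f 0 = 0"
  by (simp add: linear_ext_def)

lemma linear_ext_frag_of [simp]: "linear_ext f (frag_of v) = f v"
  by (simp add: linear_ext_def)

lemma linear_ext_add: "linear_ext f (x + y) = linear_ext f x + linear_ext f y"
proof -
  let ?S = "Poly_Mapping.keys x \<union> Poly_Mapping.keys y"
  have "Poly_Mapping.keys (x + y) \<subseteq> ?S"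
    by (rule keys_add)
  then show ?thesis
    by (simp add: linear_ext_superset[of ?S] lookup_add distrib_right sum.distrib)
qed

lemma linear_ext_uminus: "linear_ext f (- x) = - linear_ext f x"
  by (simp add: linear_ext_def sum_negf)

lemma linear_ext_diff: "linear_ext f (x - y) = linear_ext f x - linear_ext f y"
  using linear_ext_add[of f x "- y"] by (simp add: linear_ext_uminus)

lemma linear_ext_sum: "linear_ext f (sum g I) = (\<Sum>i\<in>I. linear_ext f (g i))"
  by (induction I rule: infinite_finite_induct) (auto simp: linear_ext_add)

abbreviation pairing :: "('v \<Rightarrow>\<^sub>0 int) \<Rightarrow> ('v \<Rightarrow>\<^sub>0 int) \<Rightarrow> int" where
  "pairing x y \<equiv> linear_ext (Poly_Mapping.lookup y) x"

lemma pairing_diff_right: "pairing x (y - z) = pairing x y - pairing x z"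
  by (simp add: linear_ext_def lookup_minus right_diff_distrib sum_subtractf)

lemma pairing_sum_right: "pairing x (sum g I) = (\<Sum>i\<in>I. pairing x (g i))"
  unfolding linear_ext_def lookup_sum sum_distrib_left by (rule sum.swap)

lemma pairing_commute: "pairing x y = pairing y x"
proof -
  let ?S = "Poly_Mapping.keys x \<union> Poly_Mapping.keys y"
  show ?thesis
    by (simp add: linear_ext_superset[of ?S] mult.commute)
qed

definition signed_arrows :: "'v quiver \<Rightarrow> 'v \<Rightarrow> 'v \<Rightarrow> int" where
  "signed_arrows R u w = int (arrows R u w) - int (arrows R w u)"

text \<open>The skew-symmetric bilinear form of the exchange matrix \<open>signed_arrows\<close>.
  Only the vectors have finite support, so the quiver may be infinite.\<close>

definition quiver_form :: "'v quiver \<Rightarrow> ('v \<Rightarrow>\<^sub>0 int) \<Rightarrow> ('v \<Rightarrow>\<^sub>0 int) \<Rightarrow> int" where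
  "quiver_form R x y = linear_ext (\<lambda>j. linear_ext (signed_arrows R j) y) x"

text \<open>Interchanging the finite sums shows linearity in the second argument and exposes the row
  vector of \<open>x\<close> under the exchange matrix.\<close>

lemma quiver_form_altdef:
  "quiver_form R x y = linear_ext (\<lambda>k. linear_ext (\<lambda>j. signed_arrows R j k) x) y"
  unfolding quiver_form_def linear_ext_def sum_distrib_left
  by (subst sum.swap) (simp add: mult_ac)

lemma quiver_form_swap: "quiver_form R y x = - quiver_form R x y"
proof -
  have "linear_ext (signed_arrows R j) x = - linear_ext (\<lambda>k. signed_arrows R k j) x" for j
    by (simp add: linear_ext_def signed_arrows_def algebra_simps flip: sum_negf)
  then show ?thesis
    unfolding quiver_form_altdef[of R x] quiver_form_def[of R y]
    by (simp add: linear_ext_def[of _ y] sum_negf)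
qed

lemma quiver_form_self [simp]: "quiver_form R x x = 0"
  using quiver_form_swap[of R x x] by simp

lemma quiver_form_left:
  "quiver_form R 0 y = 0"
  "quiver_form R (x + x') y = quiver_form R x y + quiver_form R x' y"
  "quiver_form R (- x) y = - quiver_form R x y"
  by (simp_all add: quiver_form_def linear_ext_add linear_ext_uminus)

lemma quiver_form_right:
  "quiver_form R x 0 = 0"
  "quiver_form R x (y + y') = quiver_form R x y + quiver_form R x y'"
  "quiver_form R x (- y) = - quiver_form R x y"
  by (simp_all add: quiver_form_altdef linear_ext_add linear_ext_uminus)

section \<open>Laurent monomials in the initial variables\<close>

lemma Var_nonzero [simp]: "Var v \<noteq> 0"
  by (simp add: subtraction_free_nonzero)

definition laurent_monomial :: "('v::linorder \<Rightarrow>\<^sub>0 int) \<Rightarrow> 'v ratfun" where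
  "laurent_monomial g =
     (\<Prod>v\<in>Poly_Mapping.keys g. Var v powi Poly_Mapping.lookup g v)"

lemma laurent_monomial_superset:
  assumes "finite S" "Poly_Mapping.keys g \<subseteq> S"
  shows "laurent_monomial g = (\<Prod>v\<in>S. Var v powi Poly_Mapping.lookup g v)"
  unfolding laurent_monomial_def using assms
  by (intro prod.mono_neutral_left) (auto simp: in_keys_iff)

lemma laurent_monomial_zero [simp]: "laurent_monomial 0 = 1"
  by (simp add: laurent_monomial_def)

lemma laurent_monomial_frag_of [simp]: "laurent_monomial (frag_of v) = Var v"
  by (simp add: laurent_monomial_def)

lemma laurent_monomial_nonzero [simp]: "laurent_monomial g \<noteq> 0"
  by (simp add: laurent_monomial_def)

lemma laurent_monomial_add:
  "laurent_monomial (g + h) = laurent_monomial g * laurent_monomial h"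
proof -
  let ?S = "Poly_Mapping.keys g \<union> Poly_Mapping.keys h"
  have "Poly_Mapping.keys (g + h) \<subseteq> ?S"
    by (rule keys_add)
  then show ?thesis
    by (simp add: laurent_monomial_superset[of ?S] lookup_add power_int_add prod.distrib)
qed

lemma laurent_monomial_diff:
  "laurent_monomial (g - h) = laurent_monomial g / laurent_monomial h"
  using laurent_monomial_add[of "g - h" h] by (simp add: field_simps)

lemma laurent_monomial_sum:
  "laurent_monomial (sum g I) = (\<Prod>i\<in>I. laurent_monomial (g i))"
  by (induction I rule: infinite_finite_induct) (auto simp: laurent_monomial_add)

lemma subtraction_free_y_var [simp]: "subtraction_free (y_var R v)"
  unfolding y_var_def
  by (intro subtraction_free_divide subtraction_free_prod subtraction_free_power subtraction_free_Var)

lemma power_int_sum: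
  fixes x :: "'a::field"
  assumes "x \<noteq> 0"
  shows "x powi (sum f I) = (\<Prod>i\<in>I. x powi f i)"
  by (induction I rule: infinite_finite_induct) (auto simp: power_int_add assms)

section \<open>Unfolding a sequence at its last mutation\<close>

lemma fst_mutate_seed_seq: "fst (mutate_seed_seq ws (R, x)) = mutate_quiver_seq ws R"
  by (induction ws arbitrary: R x)
     (auto simp: mutate_seed_seq_def mutate_quiver_seq_def mutate_seed_def)

lemma mutate_quiver_seq_snoc:
  "mutate_quiver_seq (ws @ [v]) R = mutate_quiver v (mutate_quiver_seq ws R)"
  by (simp add: mutate_quiver_seq_def)

lemma cluster_variable_Nil [simp]: "cluster_variable R [] u = Var u"
  by (simp add: cluster_variable_def mutate_seed_seq_def initial_seed_def)

lemma cluster_variable_snoc: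
  "cluster_variable R (ws @ [v]) u =
    (let R' = mutate_quiver_seq ws R; x = cluster_variable R ws in
     if u = v then
       ((\<Prod>u\<in>{u. arrows R' u v > 0}. x u ^ arrows R' u v)
            + (\<Prod>w\<in>{w. arrows R' v w > 0}. x w ^ arrows R' v w)) / x v
     else x u)"
proof -
  obtain R' x where *: "mutate_seed_seq ws (R, Var) = (R', x)"
    by force
  moreover have "R' = mutate_quiver_seq ws R"
    using fst_mutate_seed_seq[of ws R Var] * by simp
  ultimately show ?thesis
    by (simp add: cluster_variable_def initial_seed_def mutate_seed_seq_def mutate_seed_def Let_def)
qed

text \<open>The sequence mutates no frozen vertex, so the coefficients stay indeterminates.\<close>

lemma cluster_variable_Frozen [simp]:
  "cluster_variable R (map Mutable ws) (Frozen j) = Var (Frozen j)"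
  by (induction ws rule: rev_induct) (simp_all add: cluster_variable_snoc)

lemma green_sequence_Nil [simp]: "green_sequence R []"
  by (simp add: green_sequence_def)

lemma green_sequence_snoc:
  "green_sequence R (ws @ [v]) \<longleftrightarrow> green_sequence R ws \<and> v \<in> qverts R \<and>
     green_vertex (mutate_quiver_seq (map Mutable ws) (framed_quiver R)) v"
  by (auto simp: green_sequence_def nth_append less_Suc_eq)

section \<open>Monomials in the y-variables of a locally finite quiver\<close>

locale locally_finite_quiver =
  fixes R :: "'v::linorder quiver"
  assumes no_2_cycle: "arrows R u w = 0 \<or> arrows R w u = 0"
    and finite_out: "finite {w. arrows R u w > 0}"
    and finite_in: "finite {w. arrows R w u > 0}"
    and arrows_in_qverts: "arrows R u w > 0 \<Longrightarrow> u \<in> qverts R \<and> w \<in> qverts R"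
begin

text \<open>Without 2-cycles one of the two opposite counts is zero, so the positive part of the
  signed count recovers the arrows.\<close>

lemma arrows_eq_nat: "arrows R u w = nat (signed_arrows R u w)"
  using no_2_cycle[of u w] by (auto simp: signed_arrows_def)

lemma y_var_eq_prod:
  assumes "finite S" "{u. signed_arrows R v u \<noteq> 0} \<subseteq> S"
  shows "y_var R v = (\<Prod>u\<in>S. Var u powi signed_arrows R v u)"
proof -
  have S: "u \<in> S" if "arrows R v u > 0 \<or> arrows R u v > 0" for u
    using that assms(2) no_2_cycle[of v u] by (auto simp: signed_arrows_def)
  have 1: "(\<Prod>u\<in>{u. arrows R v u > 0}. Var u ^ arrows R v u) = (\<Prod>u\<in>S. Var u ^ arrows R v u)"
    using assms(1) S by (intro prod.mono_neutral_left) auto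
  have 2: "(\<Prod>w\<in>{w. arrows R w v > 0}. Var w ^ arrows R w v) = (\<Prod>w\<in>S. Var w ^ arrows R w v)"
    using assms(1) S by (intro prod.mono_neutral_left) auto
  show ?thesis
    unfolding y_var_def 1 2 prod_dividef[symmetric]
    by (simp add: signed_arrows_def power_int_diff)
qed

lemma finite_signed_arrows: "finite {u. signed_arrows R v u \<noteq> 0}"
  by (rule finite_subset[OF _ finite_UnI[OF finite_out[of v] finite_in[of v]]])
     (auto simp: signed_arrows_def)

text \<open>The exponent vector of a monomial in the \<open>y_var R j\<close> is the row vector of
  its exponents \<open>c\<close> under the exchange matrix. In a mutation this turns the coefficient
  monomial of a c-vector into a quotient of g-vector monomials.\<close>

lemma prod_y_var:
  assumes nonneg: "\<And>j. Poly_Mapping.lookup c j \<ge> 0"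
    and row: "\<And>k. linear_ext (\<lambda>j. signed_arrows R j k) c = Poly_Mapping.lookup g k"
  shows "(\<Prod>j\<in>Poly_Mapping.keys c. y_var R j ^ nat (Poly_Mapping.lookup c j)) =
    laurent_monomial g"
proof -
  \<comment> \<open>One finite index set for the support of \<open>g\<close> and all neighbours of
    the support of \<open>c\<close>, so that the double product can be swapped.\<close>
  define S where
    "S = Poly_Mapping.keys g \<union> (\<Union>j\<in>Poly_Mapping.keys c. {u. signed_arrows R j u \<noteq> 0})"
  have S: "finite S"
    using finite_signed_arrows by (auto simp: S_def)
  have "y_var R j ^ nat (Poly_Mapping.lookup c j) =
      (\<Prod>u\<in>S. Var u powi (Poly_Mapping.lookup c j * signed_arrows R j u))"
    if "j \<in> Poly_Mapping.keys c" for j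
  proof -
    have "y_var R j = (\<Prod>u\<in>S. Var u powi signed_arrows R j u)"
      by (rule y_var_eq_prod[OF S]) (use that in \<open>auto simp: S_def\<close>)
    moreover obtain n where "Poly_Mapping.lookup c j = int n"
      using nonneg[of j] nonneg_int_cases by blast
    ultimately show ?thesis
      by (simp add: prod_power_distrib power_int_mult mult.commute[of "int n"])
  qed
  then have "(\<Prod>j\<in>Poly_Mapping.keys c. y_var R j ^ nat (Poly_Mapping.lookup c j)) =
      (\<Prod>u\<in>S. \<Prod>j\<in>Poly_Mapping.keys c.
        Var u powi (Poly_Mapping.lookup c j * signed_arrows R j u))"
    by (simp add: prod.swap[of _ S])
  also have "\<dots> = (\<Prod>u\<in>S. Var u powi Poly_Mapping.lookup g u)"
    by (simp flip: row add: linear_ext_def power_int_sum)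
  also have "\<dots> = laurent_monomial g"
    using S by (simp add: laurent_monomial_superset[of S] S_def)
  finally show ?thesis .
qed

end

section \<open>The separation formula along green sequences\<close>

context locally_finite_quiver
begin

text \<open>Applied to a cluster variable of the framed quiver, the inner substitution gives its
  F-polynomial and the outer one evaluates that at the y-variables.\<close>

definition specialize :: "'v framed_vertex ratfun \<Rightarrow> 'v ratfun" where
  "specialize f = substitute (y_var R) (substitute (case_framed_vertex (\<lambda>v. 1) Var) f)"

sublocale framed: subtraction_free_substitution "case_framed_vertex (\<lambda>v. 1) Var"
  by unfold_locales (simp split: framed_vertex.split)

sublocale y: subtraction_free_substitution "y_var R"
  by unfold_locales simp

lemma specialize_one [simp]: "specialize 1 = 1"
  by (simp add: specialize_def)

lemma specialize_Var [simp]: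
  "specialize (Var (Mutable v)) = 1" "specialize (Var (Frozen v)) = y_var R v"
  by (simp_all add: specialize_def)

text \<open>The inner substitution maps subtraction-free fractions to subtraction-free ones, so the
  outer one is again compatible with the operations.\<close>

lemma specialize_hom:
  "subtraction_free f \<Longrightarrow> subtraction_free g \<Longrightarrow> specialize (f + g) = specialize f + specialize g"
  "subtraction_free f \<Longrightarrow> subtraction_free g \<Longrightarrow> specialize (f * g) = specialize f * specialize g"
  "subtraction_free f \<Longrightarrow> subtraction_free g \<Longrightarrow> specialize (f / g) = specialize f / specialize g"
  "subtraction_free f \<Longrightarrow> specialize (f ^ n) = specialize f ^ n"
  "(\<And>i. i \<in> I \<Longrightarrow> subtraction_free (h i)) \<Longrightarrow> specialize (prod h I) = (\<Prod>i\<in>I. specialize (h i))"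
  by (simp_all add: specialize_def framed.subtraction_free_substitute
      framed.substitute_add y.substitute_add framed.substitute_mult y.substitute_mult
      framed.substitute_divide y.substitute_divide framed.substitute_power y.substitute_power
      framed.substitute_prod y.substitute_prod)

lemma specialize_nonzero: "subtraction_free f \<Longrightarrow> specialize f \<noteq> 0"
  unfolding specialize_def
  by (intro subtraction_free_nonzero y.subtraction_free_substitute framed.subtraction_free_substitute)

definition framed_variable :: "'v list \<Rightarrow> 'v \<Rightarrow> 'v framed_vertex ratfun" where
  "framed_variable ws u = cluster_variable (framed_quiver R) (map Mutable ws) (Mutable u)"

abbreviation framed_arrows :: "'v list \<Rightarrow> 'v framed_vertex \<Rightarrow> 'v framed_vertex \<Rightarrow> nat" where
  "framed_arrows ws \<equiv> arrows (mutate_quiver_seq (map Mutable ws) (framed_quiver R))"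

text \<open>Along a green sequence the c-vectors \<open>C\<close> are the basis dual to the g-vectors \<open>G\<close>, and the
  current quiver is the Gram matrix of the c-vectors under the skew form of the initial quiver.\<close>

definition seed_data :: "'v list \<Rightarrow> ('v \<Rightarrow> 'v \<Rightarrow>\<^sub>0 int) \<Rightarrow> ('v \<Rightarrow> 'v \<Rightarrow>\<^sub>0 int) \<Rightarrow> bool" where
  "seed_data ws G C \<longleftrightarrow>
     green_sequence R ws \<and>
     (\<forall>u w. arrows (mutate_quiver_seq ws R) u w = nat (quiver_form R (C u) (C w))) \<and>
     (\<forall>u w. framed_arrows ws (Mutable u) (Mutable w) = nat (quiver_form R (C u) (C w))) \<and>
     (\<forall>u j. framed_arrows ws (Mutable u) (Frozen j) = nat (Poly_Mapping.lookup (C u) j)) \<and>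
     (\<forall>u j. framed_arrows ws (Frozen j) (Mutable u) = nat (- Poly_Mapping.lookup (C u) j)) \<and>
     (\<forall>u. Poly_Mapping.keys (C u) \<subseteq> qverts R) \<and>
     (\<forall>u. u \<notin> qverts R \<longrightarrow> C u = 0) \<and>
     (\<forall>u\<in>qverts R. \<forall>w\<in>qverts R. pairing (C u) (G w) = of_bool (u = w)) \<and>
     (\<forall>f. Poly_Mapping.keys f \<subseteq> qverts R \<longrightarrow> (\<forall>u\<in>qverts R. pairing f (G u) = 0) \<longrightarrow> f = 0) \<and>
     (\<forall>u. subtraction_free (framed_variable ws u)) \<and>
     (\<forall>u. cluster_variable R ws u = laurent_monomial (G u) * specialize (framed_variable ws u))"

lemma seed_dataD:
  assumes "seed_data ws G C"
  shows "green_sequence R ws"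
    and "Poly_Mapping.keys (C u) \<subseteq> qverts R"
    and "u \<in> qverts R \<Longrightarrow> w \<in> qverts R \<Longrightarrow> pairing (C u) (G w) = of_bool (u = w)"
    and "Poly_Mapping.keys f \<subseteq> qverts R \<Longrightarrow> (\<And>u. u \<in> qverts R \<Longrightarrow> pairing f (G u) = 0) \<Longrightarrow> f = 0"
    and "cluster_variable R ws u = laurent_monomial (G u) * specialize (framed_variable ws u)"
  using assms unfolding seed_data_def by auto

text \<open>Both bases start as unit vectors. \<open>C\<close> is zero off \<open>qverts R\<close>
  because the framing adds no arrows there, while \<open>G\<close> may be \<open>frag_of\<close>
  everywhere since every initial variable is \<open>Var u\<close>.\<close>

lemma seed_data_initial: "seed_data [] frag_of (\<lambda>u. if u \<in> qverts R then frag_of u else 0)"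
proof -
  have form: "arrows R u w = nat (quiver_form R
      (if u \<in> qverts R then frag_of u else 0) (if w \<in> qverts R then frag_of w else 0))" for u w
    using arrows_in_qverts[of u w]
    by (auto simp: quiver_form_def simp flip: arrows_eq_nat)
  have nondegenerate: "f = 0" if "Poly_Mapping.keys f \<subseteq> qverts R"
    "\<forall>u\<in>qverts R. pairing f (frag_of u) = 0" for f
    using that by (subst (asm) pairing_commute) (auto simp flip: keys_eq_empty)
  show ?thesis
    unfolding seed_data_def using nondegenerate
    by (auto simp: mutate_quiver_seq_def framed_quiver_def framed_variable_def
        form[symmetric] lookup_single when_def)
qed

text \<open>The hypothesis \<open>row\<close> says that \<open>In\<close> and \<open>Out\<close> are the neighbours of \<open>v\<close>, joined to it by single
  arrows: pairing it with the dual basis \<open>C\<close> gives the arrows at \<open>v\<close>.\<close>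

lemma seed_data_mutate:
  assumes data: "seed_data ws G C"
    and v: "v \<in> qverts R" "v \<notin> In" "v \<notin> Out"
    and In: "finite In" "In \<subseteq> qverts R"
    and Out: "finite Out" "Out \<subseteq> qverts R" "In \<inter> Out = {}"
    and green: "\<And>j. Poly_Mapping.lookup (C v) j \<ge> 0"
    and row: "\<And>k. linear_ext (\<lambda>j. signed_arrows R j k) (C v) =
      Poly_Mapping.lookup (sum G Out - sum G In) k"
  shows "\<exists>C'. seed_data (ws @ [v]) (G(v := sum G In - G v)) C'"
proof -
  \<comment> \<open>At a green vertex all frozen arrows point away from \<open>v\<close>, so new
    frozen arrows come only from paths through \<open>v\<close> that start in \<open>In\<close>.
    This gives the base change \<open>C'\<close>, and \<open>G'\<close> is its inverse
    transpose.\<close>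
  define G' where "G' = G(v := sum G In - G v)"
  define C' where "C' = (\<lambda>u. if u = v then - C v else if u \<in> In then C u + C v else C u)"
  let ?F = "framed_variable ws" and ?X = "cluster_variable R ws"
  have ws: "green_sequence R ws"
    and arrows: "\<And>u w. arrows (mutate_quiver_seq ws R) u w = nat (quiver_form R (C u) (C w))"
    and framed: "\<And>u w. framed_arrows ws (Mutable u) (Mutable w) = nat (quiver_form R (C u) (C w))"
      "\<And>u j. framed_arrows ws (Mutable u) (Frozen j) = nat (Poly_Mapping.lookup (C u) j)"
      "\<And>u j. framed_arrows ws (Frozen j) (Mutable u) = nat (- Poly_Mapping.lookup (C u) j)"
    and C: "\<And>u. Poly_Mapping.keys (C u) \<subseteq> qverts R" "\<And>u. u \<notin> qverts R \<Longrightarrow> C u = 0"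
    and dual: "\<And>u w. u \<in> qverts R \<Longrightarrow> w \<in> qverts R \<Longrightarrow> pairing (C u) (G w) = of_bool (u = w)"
    and nondegenerate: "\<And>f. Poly_Mapping.keys f \<subseteq> qverts R \<Longrightarrow>
      (\<And>u. u \<in> qverts R \<Longrightarrow> pairing f (G u) = 0) \<Longrightarrow> f = 0"
    and F: "\<And>u. subtraction_free (?F u)"
    and X: "\<And>u. ?X u = laurent_monomial (G u) * specialize (?F u)"
    using data unfolding seed_data_def by auto
  have dual_sum: "pairing (C u) (sum G S) = of_bool (u \<in> S)"
    if "finite S" "S \<subseteq> qverts R" for u S
  proof (cases "u \<in> qverts R")
    case True
    then have "pairing (C u) (sum G S) = (\<Sum>w\<in>S. if u = w then 1 else 0)"
      using that unfolding pairing_sum_right by (intro sum.cong) (auto simp: dual)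
    then show ?thesis
      using that by (simp add: sum.delta')
  qed (use that C in auto)
  \<comment> \<open>\<open>row\<close> turns the form with \<open>C v\<close> into the pairing with
    \<open>sum G Out - sum G In\<close>, which by duality is a difference of membership
    indicators.\<close>
  have form_v: "quiver_form R (C v) (C u) = of_bool (u \<in> Out) - of_bool (u \<in> In)" for u
    unfolding quiver_form_altdef row pairing_diff_right
    using In Out by (simp add: dual_sum)
  have form_v': "quiver_form R (C u) (C v) = of_bool (u \<in> In) - of_bool (u \<in> Out)" for u
    using quiver_form_swap[of R "C u" "C v"] form_v[of u] by simp
  have disj: "u \<in> In \<Longrightarrow> u \<notin> Out" for u
    using Out by blast
  \<comment> \<open>\<open>nat\<close> takes the positive part of the form. As \<open>C v\<close>
    has form values 0, 1 or -1 with the other c-vectors, adding it to those in \<open>In\<close> has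
    the same effect as adding paths through \<open>v\<close> and cancelling 2-cycles.\<close>
  have C'_form: "nat (quiver_form R (C' u) (C' w)) =
      (if u = v \<or> w = v then nat (quiver_form R (C w) (C u))
       else (nat (quiver_form R (C u) (C w))
             + nat (quiver_form R (C u) (C v)) * nat (quiver_form R (C v) (C w)))
          - (nat (quiver_form R (C w) (C u))
             + nat (quiver_form R (C w) (C v)) * nat (quiver_form R (C v) (C u))))" for u w
    using v quiver_form_swap[of R "C u" "C w"] disj[of u] disj[of w]
    unfolding C'_def
    by (auto simp: quiver_form_left quiver_form_right form_v form_v')
  \<comment> \<open>The same computation for the arrows to and from frozen vertices;
    \<open>green\<close> kills the paths that would start at a frozen vertex.\<close>
  have C'_lookup: "nat (Poly_Mapping.lookup (C' u) j) =
      (if u = v then nat (- Poly_Mapping.lookup (C u) j)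
       else (nat (Poly_Mapping.lookup (C u) j)
             + nat (quiver_form R (C u) (C v)) * nat (Poly_Mapping.lookup (C v) j))
          - (nat (- Poly_Mapping.lookup (C u) j)
             + nat (- Poly_Mapping.lookup (C v) j) * nat (quiver_form R (C v) (C u))))"
    "nat (- Poly_Mapping.lookup (C' u) j) =
      (if u = v then nat (Poly_Mapping.lookup (C u) j)
       else (nat (- Poly_Mapping.lookup (C u) j)
             + nat (- Poly_Mapping.lookup (C v) j) * nat (quiver_form R (C v) (C u)))
          - (nat (Poly_Mapping.lookup (C u) j)
             + nat (quiver_form R (C u) (C v)) * nat (Poly_Mapping.lookup (C v) j)))" for u j
    using green[of j] disj[of u] unfolding C'_def
    by (auto simp: form_v form_v' lookup_add)
  have framed': "framed_arrows (ws @ [v]) (Mutable u) (Mutable w) = nat (quiver_form R (C' u) (C' w))"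
    "framed_arrows (ws @ [v]) (Mutable u) (Frozen j) = nat (Poly_Mapping.lookup (C' u) j)"
    "framed_arrows (ws @ [v]) (Frozen j) (Mutable u) = nat (- Poly_Mapping.lookup (C' u) j)" for u w j
    by (simp_all add: mutate_quiver_seq_snoc mutate_quiver_def framed C'_form C'_lookup)

  \<comment> \<open>Greenness excludes frozen vertices here, so the coefficient monomial
    \<open>Y\<close> below occurs only in the outgoing product.\<close>
  have in_arrows: "{a. framed_arrows ws a (Mutable v) > 0} = Mutable ` In"
  proof (rule set_eqI)
    fix a
    show "a \<in> {a. framed_arrows ws a (Mutable v) > 0} \<longleftrightarrow> a \<in> Mutable ` In"
      using green disj by (cases a) (auto simp: framed form_v')
  qed
  have out_arrows: "{a. framed_arrows ws (Mutable v) a > 0} =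
      Mutable ` Out \<union> Frozen ` Poly_Mapping.keys (C v)"
  proof (rule set_eqI)
    fix a
    show "a \<in> {a. framed_arrows ws (Mutable v) a > 0} \<longleftrightarrow>
        a \<in> Mutable ` Out \<union> Frozen ` Poly_Mapping.keys (C v)"
      using green disj by (cases a) (auto simp: framed form_v in_keys_iff order_le_less)
  qed
  define Y where
    "Y = (\<Prod>j\<in>Poly_Mapping.keys (C v). Var (Frozen j) ^ nat (Poly_Mapping.lookup (C v) j))"
  have "(\<Prod>a\<in>Mutable ` In. cluster_variable (framed_quiver R) (map Mutable ws) a
      ^ framed_arrows ws a (Mutable v)) = (\<Prod>u\<in>In. ?F u)"
    by (subst prod.reindex)
       (auto simp: inj_on_def framed form_v' framed_variable_def disj intro!: prod.cong)
  moreover have "(\<Prod>a\<in>Mutable ` Out \<union> Frozen ` Poly_Mapping.keys (C v).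
      cluster_variable (framed_quiver R) (map Mutable ws) a ^ framed_arrows ws (Mutable v) a) =
      (\<Prod>u\<in>Out. ?F u) * Y"
    unfolding Y_def
    by (subst prod.union_disjoint)
       (auto simp: Out inj_on_def prod.reindex framed form_v framed_variable_def
         dest: disj intro!: arg_cong2[of _ _ _ _ "(*)"] prod.cong)
  ultimately have F': "framed_variable (ws @ [v]) = ?F(v := ((\<Prod>u\<in>In. ?F u) + (\<Prod>u\<in>Out. ?F u) * Y) / ?F v)"
    by (auto simp: fun_eq_iff framed_variable_def[of "ws @ [v]"] cluster_variable_snoc Let_def
        in_arrows out_arrows framed_variable_def[of ws])
  have Y: "subtraction_free Y"
    unfolding Y_def by (intro subtraction_free_prod subtraction_free_power subtraction_free_Var)
  \<comment> \<open>Thus the coefficient specializes to the ratio of the g-vector monomials of the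
    two sides of the exchange relation.\<close>
  have "specialize Y = laurent_monomial (sum G Out - sum G In)"
    unfolding Y_def prod_y_var[OF green row, symmetric]
    by (simp add: specialize_hom subtraction_free_power)
  note Y = Y this
  have "{u. arrows (mutate_quiver_seq ws R) u v > 0} = In"
    "{w. arrows (mutate_quiver_seq ws R) v w > 0} = Out"
    using disj by (auto simp: arrows form_v form_v')
  then have X': "cluster_variable R (ws @ [v]) = ?X(v := ((\<Prod>u\<in>In. ?X u) + (\<Prod>u\<in>Out. ?X u)) / ?X v)"
    using disj
    by (auto simp: fun_eq_iff cluster_variable_snoc Let_def arrows form_v form_v'
        intro!: arg_cong2[of _ _ _ _ "(+)"] arg_cong2[of _ _ _ _ "(/)"] prod.cong)
  have F'_free: "subtraction_free (framed_variable (ws @ [v]) u)" for u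
    unfolding F' using F Y
    by (auto intro!: subtraction_free_divide subtraction_free_add subtraction_free_mult
        subtraction_free_prod)
  \<comment> \<open>Taking \<open>laurent_monomial (sum G In)\<close> out of the numerator of the
    exchange relation leaves the specialized framed relation; dividing by the monomial of
    \<open>G v\<close> gives that of \<open>G' v\<close>.\<close>
  have separation: "cluster_variable R (ws @ [v]) u =
      laurent_monomial (G' u) * specialize (framed_variable (ws @ [v]) u)" for u
  proof (cases "u = v")
    case True
    have 1: "specialize (framed_variable (ws @ [v]) v) =
        ((\<Prod>u\<in>In. specialize (?F u)) + (\<Prod>u\<in>Out. specialize (?F u))
          * (laurent_monomial (sum G Out) / laurent_monomial (sum G In))) / specialize (?F v)"
      unfolding F' using F Y
      by (simp add: specialize_hom subtraction_free_add subtraction_free_mult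
          subtraction_free_prod laurent_monomial_diff)
    have 2: "cluster_variable R (ws @ [v]) v =
        (laurent_monomial (sum G In) * (\<Prod>u\<in>In. specialize (?F u))
          + laurent_monomial (sum G Out) * (\<Prod>u\<in>Out. specialize (?F u)))
        / (laurent_monomial (G v) * specialize (?F v))"
      unfolding X' by (simp add: X prod.distrib laurent_monomial_sum)
    have "specialize (?F v) \<noteq> 0"
      using F by (rule specialize_nonzero)
    then show ?thesis
      unfolding True 1 2 by (simp add: G'_def laurent_monomial_diff field_simps)
  next
    case False
    then show ?thesis
      by (simp add: X' F' X G'_def)
  qed

  have keys': "Poly_Mapping.keys (C' u) \<subseteq> qverts R" for u
  proof -
    have "Poly_Mapping.keys (C u + C v) \<subseteq> qverts R"
      using C(1)[of u] C(1)[of v] keys_add[of "C u" "C v"] by blast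
    then show ?thesis
      using C(1) by (simp add: C'_def)
  qed
  have zero': "C' u = 0" if "u \<notin> qverts R" for u
    using that v In C(2) by (auto simp: C'_def)
  have dual': "pairing (C' u) (G' w) = of_bool (u = w)" if "u \<in> qverts R" "w \<in> qverts R" for u w
    using that v In dual
    by (auto simp: C'_def G'_def linear_ext_add linear_ext_uminus pairing_diff_right dual_sum)
  \<comment> \<open>The old \<open>G v\<close> is \<open>sum G In - G' v\<close>, and
    \<open>In\<close> omits \<open>v\<close>, so a vector orthogonal to the new family is orthogonal
    to the old one.\<close>
  have nondegenerate': "f = 0" if f: "Poly_Mapping.keys f \<subseteq> qverts R"
    "\<And>u. u \<in> qverts R \<Longrightarrow> pairing f (G' u) = 0" for f
  proof (rule nondegenerate[OF f(1)])
    fix u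
    assume u: "u \<in> qverts R"
    have *: "pairing f (G w) = 0" if "w \<in> qverts R" "w \<noteq> v" for w
      using f(2)[OF that(1)] that(2) by (simp add: G'_def)
    have "pairing f (sum G In) = 0"
      unfolding pairing_sum_right using In v by (intro sum.neutral) (auto intro!: *)
    then have "pairing f (G v) = 0"
      using f(2)[OF v(1)] by (simp add: G'_def pairing_diff_right)
    then show "pairing f (G u) = 0"
      using * u by (cases "u = v") auto
  qed
  have "green_sequence R (ws @ [v])"
    using ws v green by (auto simp: green_sequence_snoc green_vertex_def framed)
  then have "seed_data (ws @ [v]) G' C'"
    unfolding seed_data_def
    using framed' keys' zero' dual' nondegenerate' F'_free separation
    by (auto simp: mutate_quiver_seq_snoc mutate_quiver_def arrows C'_form)
  then show ?thesis
    unfolding G'_def by blast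
qed

end

section \<open>T-systems in the Hernandez--Leclerc quiver\<close>

lemma dynkin_arrows_range:
  "valid_type X \<Longrightarrow> (i, j) \<in> dynkin_arrows X \<Longrightarrow> i \<in> {1..type_rank X} \<and> j \<in> {1..type_rank X}"
  by (cases X) (auto simp: chain_arrows_def split: if_splits)

text \<open>The orientation is alternating, so no head of an arrow is a tail. The case
  \<open>k = i\<close> excludes 2-cycles and \<open>i = j = k\<close> excludes loops.\<close>

lemma dynkin_arrows_bipartite:
  assumes "valid_type X" "(i, j) \<in> dynkin_arrows X"
  shows "(j, k) \<notin> dynkin_arrows X"
proof (cases X)
  case (A n)
  then show ?thesis
    using assms by (auto simp: chain_arrows_def)
next
  case (D n)
  \<comment> \<open>Removes the truncated subtraction from \<open>n - 2\<close>.\<close>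
  moreover obtain n' where "n = n' + 2"
    using assms(1) D by (metis add.commute le_Suc_ex numeral_Bit0 order_trans le_add1 valid_type.simps(2))
  ultimately show ?thesis
    using assms by (auto simp: chain_arrows_def split: if_splits)
qed (use assms in auto)

text \<open>In a chain \<open>i div 2\<close> jumps on reaching an even vertex, which is a source:
  it exceeds its left neighbour by one and equals its right neighbour. The branches and the
  exceptional types are checked directly.\<close>

lemma right_endpoint_slice:
  assumes "valid_type X" "(i, j) \<in> dynkin_arrows X"
  shows "right_endpoint X m j \<le> right_endpoint X m i \<and>
    right_endpoint X m i \<le> right_endpoint X m j + 1"
proof (cases X)
  case (A n)
  then show ?thesis
    using assms by (auto simp: chain_arrows_def)
next
  case (D n)
  moreover obtain n' where "n = n' + 2"
    using assms(1) D by (metis add.commute le_Suc_ex numeral_Bit0 order_trans le_add1 valid_type.simps(2))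
  ultimately show ?thesis
    using assms by (auto simp: chain_arrows_def split: if_splits)
qed (use assms in auto)

section \<open>Arrows and unit vectors of the Hernandez-Leclerc quiver\<close>

lemma qverts_HL_quiver: "qverts (HL_quiver X) = {1..type_rank X} \<times> {1..}"
  by (simp add: HL_quiver_def triangular_product_def dynkin_quiver_def A_infinity_def)

lemma arrows_HL_quiver:
  "arrows (HL_quiver X) (i, t) (j, k) =
     of_bool (t = k \<and> t \<ge> 1 \<and> (i, j) \<in> dynkin_arrows X)
     + of_bool (i = j \<and> i \<in> {1..type_rank X} \<and> t = k + 1 \<and> k \<ge> 1)
     + of_bool ((j, i) \<in> dynkin_arrows X \<and> k = t + 1 \<and> t \<ge> 1)"
  by (auto simp: HL_quiver_def triangular_product_def dynkin_quiver_def A_infinity_def)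

lemma locally_finite_HL_quiver:
  assumes X: "valid_type X"
  shows "locally_finite_quiver (HL_quiver X)"
proof
  fix u w :: "nat \<times> nat"
  show "arrows (HL_quiver X) u w = 0 \<or> arrows (HL_quiver X) w u = 0"
    using dynkin_arrows_bipartite[OF X]
    by (cases u; cases w) (auto simp: arrows_HL_quiver)
  show *: "u \<in> qverts (HL_quiver X) \<and> w \<in> qverts (HL_quiver X)" if "arrows (HL_quiver X) u w > 0" for u w
    using that dynkin_arrows_range[OF X]
    by (cases u; cases w) (force simp: arrows_HL_quiver qverts_HL_quiver split: if_splits)
  \<comment> \<open>An arrow changes the height by at most one, and there are finitely many
    columns.\<close>
  let ?S = "{1..type_rank X} \<times> {..snd u + 1}"
  have "w \<in> ?S" if "arrows (HL_quiver X) u w > 0 \<or> arrows (HL_quiver X) w u > 0" for w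
  proof -
    have "snd w \<le> snd u + 1"
      using that by (cases u; cases w) (auto simp: arrows_HL_quiver split: if_splits)
    moreover have "w \<in> qverts (HL_quiver X)"
      using that * by blast
    ultimately show ?thesis
      by (auto simp: qverts_HL_quiver)
  qed
  then have "{w. arrows (HL_quiver X) u w > 0} \<subseteq> ?S" "{w. arrows (HL_quiver X) w u > 0} \<subseteq> ?S"
    by blast+
  then show "finite {w. arrows (HL_quiver X) u w > 0}" "finite {w. arrows (HL_quiver X) w u > 0}"
    by (auto intro: finite_subset)
qed

definition node_vec :: "nat \<Rightarrow> nat \<Rightarrow> (nat \<times> nat) \<Rightarrow>\<^sub>0 int" where
  "node_vec i k = (if k = 0 then 0 else frag_of (i, k))"

lemma lookup_node_vec: "Poly_Mapping.lookup (node_vec i k) (j, t) = of_bool (i = j \<and> k = t \<and> k \<noteq> 0)"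
  by (auto simp: node_vec_def lookup_single when_def)

lemma unit_vec_eq_lookup: "unit_vec (i, k) w = Poly_Mapping.lookup (node_vec i k) w"
  by (cases w) (auto simp: unit_vec_def lookup_node_vec)

lemma sum_of_bool_interval:
  fixes c :: nat
  shows "(\<Sum>t=a+1..b. of_bool (t = c) :: int) = of_bool (a < c \<and> c \<le> b)"
    and "(\<Sum>t=a+1..b. of_bool (t = c + 1) :: int) = of_bool (a \<le> c \<and> c < b)"
    and "(\<Sum>t=a+1..b. of_bool (c = t + 1) :: int) = of_bool (a + 1 < c \<and> c \<le> b + 1)"
proof -
  have *: "(\<Sum>t=a+1..b. of_bool (t = d) :: int) = of_bool (a < d \<and> d \<le> b)" for d
    unfolding of_bool_def by (subst sum.delta) auto
  show "(\<Sum>t=a+1..b. of_bool (t = c) :: int) = of_bool (a < c \<and> c \<le> b)"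
    by (rule *)
  show "(\<Sum>t=a+1..b. of_bool (t = c + 1) :: int) = of_bool (a \<le> c \<and> c < b)"
    unfolding * by auto
  \<comment> \<open>For \<open>c = 0\<close> the truncated \<open>c - 1\<close> is 0, which the
    range misses because it starts at \<open>a + 1\<close>.\<close>
  have "(\<Sum>t=a+1..b. of_bool (c = t + 1) :: int) = (\<Sum>t=a+1..b. of_bool (t = c - 1))"
    by (intro sum.cong) auto
  also have "\<dots> = of_bool (a + 1 < c \<and> c \<le> b + 1)"
    unfolding * by auto
  finally show "(\<Sum>t=a+1..b. of_bool (c = t + 1) :: int) = of_bool (a + 1 < c \<and> c \<le> b + 1)" .
qed

section \<open>Sweeps of T-system mutations\<close>

locale dynkin_slice =
  fixes X :: dynkin_type and r :: "nat \<Rightarrow> nat"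
  assumes valid: "valid_type X"
    and slice: "(i, j) \<in> dynkin_arrows X \<Longrightarrow> r j \<le> r i \<and> r i \<le> r j + 1"
begin

sublocale HL: locally_finite_quiver "HL_quiver X"
  by (rule locally_finite_HL_quiver[OF valid])

text \<open>\<open>n i p\<close> counts the mutations performed at \<open>(i, p)\<close>; each of them is a T-system relation and
  moves the support of the module at \<open>(i, p)\<close> by one, to \<open>[n i p + 1, n i p + p]\<close>.\<close>

definition reachable :: "(nat \<Rightarrow> nat \<Rightarrow> nat) \<Rightarrow> bool" where
  "reachable n \<longleftrightarrow> (\<exists>ws G C. HL.seed_data ws G C \<and>
     (\<forall>i\<in>{1..type_rank X}. \<forall>p\<ge>1. G (i, p) = node_vec i (n i p + p) - node_vec i (n i p)))"

text \<open>Counts at height 0 or outside the diagram belong to no vertex and may be changed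
  freely.\<close>

lemma reachable_cong:
  assumes "reachable n" "\<And>i p. i \<in> {1..type_rank X} \<Longrightarrow> p \<ge> 1 \<Longrightarrow> n' i p = n i p"
  shows "reachable n'"
  using assms unfolding reachable_def by metis

lemma reachable_zero: "reachable (\<lambda>i p. 0)"
  unfolding reachable_def
  by (rule exI[of _ "[]"], rule exI[of _ frag_of], rule exI)
     (use HL.seed_data_initial in \<open>auto simp: node_vec_def\<close>)

text \<open>Shifted copies of the interval cancel except near their ends. With e_k the unit vector
  at height k, column \<open>i\<close> keeps e_a + e_(a+1) - e_(a+p) - e_(a+p+1), an out-neighbour
  e_(a+p) - e_a, and an in-neighbour e_(a+p+1) - e_(a+1). The factor
  \<open>of_bool (k \<ge> 1)\<close> discards the missing height 0.\<close>

lemma sum_signed_arrows: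
  assumes "i \<in> {1..type_rank X}"
  shows "(\<Sum>t=a+1..a+p. signed_arrows (HL_quiver X) (i, t) (j, k)) = of_bool (k \<ge> 1) *
    (of_bool (i = j) * (of_bool (a \<le> k \<and> k < a + p) - of_bool (a + 1 < k \<and> k \<le> a + p + 1))
     + of_bool ((i, j) \<in> dynkin_arrows X)
         * (of_bool (a < k \<and> k \<le> a + p) - of_bool (a \<le> k \<and> k < a + p))
     + of_bool ((j, i) \<in> dynkin_arrows X)
         * (of_bool (a + 1 < k \<and> k \<le> a + p + 1) - of_bool (a < k \<and> k \<le> a + p)))"
proof (cases "k \<ge> 1")
  case True
  have "signed_arrows (HL_quiver X) (i, t) (j, k) =
      of_bool (i = j) * (of_bool (t = k + 1) - of_bool (k = t + 1))
      + of_bool ((i, j) \<in> dynkin_arrows X) * (of_bool (t = k) - of_bool (t = k + 1))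
      + of_bool ((j, i) \<in> dynkin_arrows X) * (of_bool (k = t + 1) - of_bool (t = k))"
    if "t \<in> {a+1..a+p}" for t
    using that True assms dynkin_arrows_bipartite[OF valid]
    by (auto simp: signed_arrows_def arrows_HL_quiver)
  then have "(\<Sum>t=a+1..a+p. signed_arrows (HL_quiver X) (i, t) (j, k)) = (\<Sum>t=a+1..a+p.
      of_bool (i = j) * (of_bool (t = k + 1) - of_bool (k = t + 1))
      + of_bool ((i, j) \<in> dynkin_arrows X) * (of_bool (t = k) - of_bool (t = k + 1))
      + of_bool ((j, i) \<in> dynkin_arrows X) * (of_bool (k = t + 1) - of_bool (t = k)))"
    by (intro sum.cong) auto
  then show ?thesis
    unfolding sum.distrib sum_distrib_left[symmetric] sum_subtractf sum_of_bool_interval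
    using True by simp
next
  case False
  then show ?thesis
    by (auto simp: signed_arrows_def arrows_HL_quiver intro!: sum.neutral)
qed

text \<open>The T-system at support [a+1, a+p]: one side multiplies the supports [a+2, a+p] and
  [a+1, a+p+1] in column \<open>i\<close>, the other the neighbouring supports of length
  \<open>p\<close>, which \<open>source\<close> and \<open>sink\<close> place at \<open>a\<close>
  and \<open>a + 1\<close>. By \<open>below\<close> and \<open>above\<close>, both ends of each
  other g-vector of the column lie inside, or both outside, the support, so its indicator is the
  dual vector.\<close>

lemma reachable_mutate:
  assumes n: "reachable n" and i: "i \<in> {1..type_rank X}" and p: "p \<ge> 1"
    and below: "\<And>q. 1 \<le> q \<Longrightarrow> q < p \<Longrightarrow> n i q > n i p \<and> n i q + q \<le> n i p + p"
    and above: "\<And>q. q > p \<Longrightarrow> n i q \<le> n i p \<and> n i q + q > n i p + p"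
    and source: "\<And>j. (i, j) \<in> dynkin_arrows X \<Longrightarrow> n j p = n i p"
    and sink: "\<And>j. (j, i) \<in> dynkin_arrows X \<Longrightarrow> n j p = n i p + 1"
  shows "reachable (n(i := (n i)(p := n i p + 1)))"
proof -
  let ?A = "dynkin_arrows X" and ?a = "n i p"
  obtain ws G C where data: "HL.seed_data ws G C"
    and G: "\<And>j q. j \<in> {1..type_rank X} \<Longrightarrow> q \<ge> 1 \<Longrightarrow>
      G (j, q) = node_vec j (n j q + q) - node_vec j (n j q)"
    using n unfolding reachable_def by blast
  have qverts: "(j, q) \<in> qverts (HL_quiver X) \<longleftrightarrow> j \<in> {1..type_rank X} \<and> q \<ge> 1" for j q
    by (auto simp: qverts_HL_quiver)
  \<comment> \<open>At adjacent heights the two bounds in \<open>below\<close>, and those in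
    \<open>above\<close>, leave a single value.\<close>
  have prev: "n i (p - 1) = ?a + 1" if "p > 1"
  proof -
    have "1 \<le> p - 1" "p - 1 < p"
      using that by auto
    from below[OF this] that show ?thesis
      by linarith
  qed
  have next_: "n i (p + 1) = ?a"
    using above[of "p + 1"] by auto

  \<comment> \<open>The expected c-vector: the indicator of the current support.\<close>
  define c where "c = (\<Sum>t=?a+1..?a+p. frag_of (i, t))"
  have pairing_c: "pairing c (G (j, q)) = of_bool ((i, p) = (j, q))"
    if "j \<in> {1..type_rank X}" "q \<ge> 1" for j q
  proof -
    have "pairing c (node_vec j m) = of_bool (i = j \<and> ?a < m \<and> m \<le> ?a + p)" for m
    proof -
      have "pairing c (node_vec j m) = (\<Sum>t=?a+1..?a+p. of_bool (i = j) * of_bool (t = m))"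
        unfolding c_def linear_ext_sum
        by (intro sum.cong) (auto simp: lookup_node_vec)
      then show ?thesis
        unfolding sum_distrib_left[symmetric] sum_of_bool_interval by auto
    qed
    then show ?thesis
      using that below[of q] above[of q] p
      by (cases q p rule: linorder_cases) (auto simp: G pairing_diff_right)
  qed
  \<comment> \<open>Both vectors have the same pairings with all g-vectors, and nondegeneracy makes
    them equal.\<close>
  have C: "C (i, p) = c"
  proof -
    have "Poly_Mapping.keys c \<subseteq> qverts (HL_quiver X)"
      unfolding c_def using i by (intro order_trans[OF keys_sum]) (auto simp: qverts_HL_quiver)
    then have "Poly_Mapping.keys (C (i, p) - c) \<subseteq> qverts (HL_quiver X)"
      using keys_diff[of "C (i, p)" c] HL.seed_dataD(2)[OF data, of "(i, p)"] by blast
    moreover have "pairing (C (i, p) - c) (G u) = 0" if "u \<in> qverts (HL_quiver X)" for u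
    proof -
      have "pairing (C (i, p)) (G u) = of_bool ((i, p) = u)"
        using that i p by (intro HL.seed_dataD(3)[OF data]) (auto simp: qverts)
      moreover have "pairing c (G u) = of_bool ((i, p) = u)"
        using that by (cases u) (auto simp: qverts pairing_c)
      ultimately show ?thesis
        by (simp add: linear_ext_diff)
    qed
    ultimately have "C (i, p) - c = 0"
      by (rule HL.seed_dataD(4)[OF data])
    then show ?thesis
      by simp
  qed

  define nbr where "nbr = {j. (i, j) \<in> ?A \<or> (j, i) \<in> ?A}"
  define In where "In = insert (i, p + 1) (if p > 1 then {(i, p - 1)} else {})"
  define Out where "Out = (\<lambda>j. (j, p)) ` nbr"
  have nbr: "nbr \<subseteq> {1..type_rank X}" "i \<notin> nbr"
    using dynkin_arrows_range[OF valid] dynkin_arrows_bipartite[OF valid, of i i i]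
    by (auto simp: nbr_def)
  then have [simp]: "finite nbr"
    by (auto intro: finite_subset)
  \<comment> \<open>For \<open>p = 1\<close> there is no vertex \<open>(i, p - 1)\<close>, and
    correspondingly the last bracket vanishes.\<close>
  have sum_In: "sum G In =
      node_vec i (?a + p + 1) - node_vec i ?a + (node_vec i (?a + p) - node_vec i (?a + 1))"
  proof -
    have 1: "G (i, p + 1) = node_vec i (?a + p + 1) - node_vec i ?a"
      using G[OF i, of "p + 1"] unfolding next_ by (simp add: add.assoc)
    show ?thesis
    proof (cases "p > 1")
      case True
      then have "?a + 1 + (p - 1) = ?a + p"
        by simp
      with True have "G (i, p - 1) = node_vec i (?a + p) - node_vec i (?a + 1)"
        using G[OF i, of "p - 1"] unfolding prev[OF True] by simp
      then show ?thesis
        using True 1 by (simp add: In_def)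
    next
      case False
      then show ?thesis
        using p 1 by (simp add: In_def)
    qed
  qed
  have sum_Out: "Poly_Mapping.lookup (sum G Out) (j, k) =
      (if j \<in> nbr then Poly_Mapping.lookup (G (j, p)) (j, k) else 0)" for j k
  proof -
    have "Poly_Mapping.lookup (sum G Out) (j, k) =
        (\<Sum>j'\<in>nbr. Poly_Mapping.lookup (G (j', p)) (j, k))"
      by (simp add: Out_def sum.reindex inj_on_def lookup_sum)
    also have "\<dots> = (\<Sum>j'\<in>nbr. if j' = j then Poly_Mapping.lookup (G (j, p)) (j, k) else 0)"
    proof (intro sum.cong refl)
      fix j'
      assume "j' \<in> nbr"
      then have "G (j', p) = node_vec j' (n j' p + p) - node_vec j' (n j' p)"
        using nbr p by (intro G) auto
      then show "Poly_Mapping.lookup (G (j', p)) (j, k) =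
          (if j' = j then Poly_Mapping.lookup (G (j, p)) (j, k) else 0)"
        by (cases "j' = j") (simp_all add: lookup_minus lookup_node_vec)
    qed
    finally show ?thesis
      by simp
  qed
  let ?G' = "G((i, p) := sum G In - G (i, p))"
  have "\<exists>C'. HL.seed_data (ws @ [(i, p)]) ?G' C'"
  proof (rule HL.seed_data_mutate[OF data, where Out = Out])
    show "(i, p) \<in> qverts (HL_quiver X)" "In \<subseteq> qverts (HL_quiver X)" "Out \<subseteq> qverts (HL_quiver X)"
      using i p nbr by (auto simp: qverts In_def Out_def)
    show "(i, p) \<notin> In" "(i, p) \<notin> Out" "finite In" "finite Out" "In \<inter> Out = {}"
      using p nbr by (auto simp: In_def Out_def)
    show "Poly_Mapping.lookup (C (i, p)) j \<ge> 0" for j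
      unfolding C c_def lookup_sum by (intro sum_nonneg) (auto simp: lookup_single when_def)
    fix u :: "nat \<times> nat"
    obtain j k where u: "u = (j, k)"
      by force
    have "linear_ext (\<lambda>v. signed_arrows (HL_quiver X) v u) (C (i, p)) =
        (\<Sum>t=?a+1..?a+p. signed_arrows (HL_quiver X) (i, t) (j, k))"
      unfolding C c_def linear_ext_sum u by simp
    also have "\<dots> = Poly_Mapping.lookup (sum G Out - sum G In) (j, k)"
    proof -
      consider "j = i" | "(i, j) \<in> ?A" | "(j, i) \<in> ?A" | "j \<noteq> i" "j \<notin> nbr"
        by (auto simp: nbr_def)
      then show ?thesis
      proof cases
        case 1
        then show ?thesis
          unfolding sum_signed_arrows[OF i]
          using nbr i p dynkin_arrows_bipartite[OF valid, of i i i]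
          by (auto simp: lookup_minus lookup_add sum_Out sum_In lookup_node_vec)
      next
        case 2
        then have "j \<in> nbr" "(j, i) \<notin> ?A" "i \<noteq> j" "n j p = ?a"
          using dynkin_arrows_bipartite[OF valid] source by (auto simp: nbr_def)
        then show ?thesis
          unfolding sum_signed_arrows[OF i]
          using 2 nbr i p
          by (auto simp: lookup_minus lookup_add sum_Out sum_In lookup_node_vec G)
      next
        case 3
        then have "j \<in> nbr" "(i, j) \<notin> ?A" "i \<noteq> j" "n j p = ?a + 1"
          using dynkin_arrows_bipartite[OF valid] sink by (auto simp: nbr_def)
        then show ?thesis
          unfolding sum_signed_arrows[OF i]
          using 3 nbr i p
          by (auto simp: lookup_minus lookup_add sum_Out sum_In lookup_node_vec G)
      next
        case 4
        then show ?thesis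
          unfolding sum_signed_arrows[OF i]
          by (auto simp: nbr_def lookup_minus lookup_add sum_Out sum_In lookup_node_vec)
      qed
    qed
    finally show "linear_ext (\<lambda>v. signed_arrows (HL_quiver X) v u) (C (i, p)) =
        Poly_Mapping.lookup (sum G Out - sum G In) u"
      by (simp add: u)
  qed
  \<comment> \<open>In the g-vector recursion all but the two ends of the support shifted by one
    cancel.\<close>
  moreover have "sum G In - G (i, p) = node_vec i (?a + 1 + p) - node_vec i (?a + 1)"
    using i p by (simp add: sum_In G)
  then have "?G' (j, q) = node_vec j ((n(i := (n i)(p := ?a + 1))) j q + q)
      - node_vec j ((n(i := (n i)(p := ?a + 1))) j q)" if "j \<in> {1..type_rank X}" "q \<ge> 1" for j q
    using G[OF that] by (cases "j = i"; cases "q = p") simp_all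
  ultimately show ?thesis
    unfolding reachable_def by blast
qed

text \<open>The counts after \<open>a\<close> full sweeps and the columns \<open>S\<close> of the
  next one. The cap \<open>r i - p\<close> stops a vertex once its support ends at
  \<open>r i\<close>; for \<open>p \<ge> r i\<close> it is zero.\<close>

definition level :: "nat \<Rightarrow> nat set \<Rightarrow> nat \<Rightarrow> nat \<Rightarrow> nat" where
  "level a S i p = min (r i - p) (if i \<in> S then a + 1 else a)"

text \<open>Mutating upwards from height 1 to \<open>r i - a - 1\<close> ensures that at height
  \<open>p\<close> the shorter support has already moved and the longer one has not.\<close>

lemma reachable_column:
  assumes n: "reachable (level a S)" and i: "i \<in> {1..type_rank X}" "i \<notin> S"
    and source: "\<And>j. (i, j) \<in> dynkin_arrows X \<Longrightarrow> j \<notin> S"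
    and sink: "\<And>j. (j, i) \<in> dynkin_arrows X \<Longrightarrow> j \<in> S"
  shows "reachable (level a (insert i S))"
proof -
  define f where "f = (\<lambda>p q. min (r i - q) (if q < p then a + 1 else a))"
  have columns: "reachable ((level a S)(i := f p))" if "1 \<le> p" "p \<le> r i - a" for p
    using that
  proof (induction p rule: dec_induct)
    case base
    show ?case
      by (rule reachable_cong[OF n]) (auto simp: f_def level_def i)
  next
    case (step p)
    have p: "p + a < r i"
      using step.prems step.hyps by simp
    let ?n = "(level a S)(i := f p)"
    have n_p: "?n i p = a"
      using p by (simp add: f_def)
    have "reachable (?n(i := (?n i)(p := ?n i p + 1)))"
    proof (rule reachable_mutate)
      show "reachable ?n"
        by (rule step.IH) (use step.prems in simp)
      show "?n i q > ?n i p \<and> ?n i q + q \<le> ?n i p + p" if "1 \<le> q" "q < p" for q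
        using that p unfolding n_p by (auto simp: f_def)
      show "?n i q \<le> ?n i p \<and> ?n i q + q > ?n i p + p" if "q > p" for q
        using that p unfolding n_p by (auto simp: f_def)
      \<comment> \<open>Here \<open>r j \<ge> r i - 1 \<ge> p + a\<close>, so the cap does not push
        column \<open>j\<close> below \<open>a\<close>.\<close>
      show "?n j p = ?n i p" if "(i, j) \<in> dynkin_arrows X" for j
        using that source[OF that] slice[OF that] dynkin_arrows_bipartite[OF valid that] p
        unfolding n_p by (auto simp: level_def)
      \<comment> \<open>Here \<open>r j \<ge> r i \<ge> p + a + 1\<close>, so the cap allows the
        value \<open>a + 1\<close>.\<close>
      show "?n j p = ?n i p + 1" if "(j, i) \<in> dynkin_arrows X" for j
        using that sink[OF that] slice[OF that] dynkin_arrows_bipartite[OF valid that] p i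
        unfolding n_p by (auto simp: level_def)
    qed (use i step in auto)
    then show ?case
      by (rule reachable_cong) (use p in \<open>auto simp: f_def\<close>)
  qed
  show ?thesis
  proof (cases "r i \<le> a")
    case True
    then show ?thesis
      by (intro reachable_cong[OF n]) (auto simp: level_def)
  next
    case False
    \<comment> \<open>From height \<open>r i - a\<close> on the cap is at most \<open>a\<close>, so
      the column is finished.\<close>
    then have "reachable ((level a S)(i := f (r i - a)))"
      by (intro columns) auto
    then show ?thesis
      by (rule reachable_cong) (auto simp: level_def f_def)
  qed
qed

text \<open>A source column needs its sink neighbours unmoved, and a sink column needs its source
  neighbours moved. Within either class no columns are adjacent, so any order works.\<close>

lemma reachable_sweep:
  assumes n: "reachable (level a {})"
  shows "reachable (level (Suc a) {})"
proof -
  define sources where "sources = {i\<in>{1..type_rank X}. is_source X i}"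
  define sinks where "sinks = {i\<in>{1..type_rank X}. \<not> is_source X i}"
  have "reachable (level a S)" if "finite S" "S \<subseteq> sources" for S
    using that
  proof (induction S)
    case (insert i S)
    then show ?case
      using dynkin_arrows_bipartite[OF valid]
      by (intro reachable_column) (auto simp: sources_def is_source_def)
  qed (rule n)
  then have sources: "reachable (level a sources)"
    by (simp add: sources_def)
  have "reachable (level a (S \<union> sources))" if "finite S" "S \<subseteq> sinks" for S
    using that
  proof (induction S)
    case (insert i S)
    then show ?case
      unfolding Un_insert_left using dynkin_arrows_range[OF valid]
      by (intro reachable_column) (auto simp: sources_def sinks_def is_source_def)
  qed (simp add: sources)
  then have "reachable (level a (sinks \<union> sources))"
    by (simp add: sinks_def)
  then show ?thesis
    by (rule reachable_cong) (auto simp: level_def sinks_def sources_def)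
qed

section \<open>The final seed and its modules\<close>

lemma reachable_final: "reachable (\<lambda>i p. r i - p)"
proof -
  have "reachable (level a {})" for a
  proof (induction a)
    case 0
    show ?case
      by (rule reachable_cong[OF reachable_zero]) (simp add: level_def)
  qed (rule reachable_sweep)
  \<comment> \<open>The sum is a convenient bound for every \<open>r i\<close>; after that many
    sweeps all caps are attained.\<close>
  then have "reachable (level (\<Sum>i\<in>{1..type_rank X}. r i) {})" .
  then show ?thesis
  proof (rule reachable_cong)
    fix i p
    assume "i \<in> {1..type_rank X}"
    then have "r i \<le> (\<Sum>i\<in>{1..type_rank X}. r i)"
      by (intro member_le_sum) auto
    then show "r i - p = level (\<Sum>i\<in>{1..type_rank X}. r i) {} i p"
      by (simp add: level_def)
  qed
qed

lemma exists_green_sequence: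
  "\<exists>\<S>. green_sequence (HL_quiver X) \<S> \<and>
     (\<forall>i\<in>{1..type_rank X}. \<forall>l\<in>{1..r i}. \<exists>u\<in>qverts (HL_quiver X).
        corresponds X \<S> u (KR X i (r i - l + 1) (r i)))"
proof -
  obtain ws G C where data: "HL.seed_data ws G C"
    and G: "\<And>i p. i \<in> {1..type_rank X} \<Longrightarrow> p \<ge> 1 \<Longrightarrow>
      G (i, p) = node_vec i (r i - p + p) - node_vec i (r i - p)"
    using reachable_final unfolding reachable_def by blast
  \<comment> \<open>At height \<open>p = r i - l + 1\<close> the support starts after
    \<open>r i - p = l - 1\<close>, which serves as \<open>d\<close>, with
    \<open>k = p\<close>.\<close>
  have "corresponds X ws (i, r i - l + 1) (KR X i (r i - l + 1) (r i))"
    if i: "i \<in> {1..type_rank X}" and l: "l \<in> {1..r i}" for i l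
  proof -
    let ?u = "(i, r i - l + 1)"
    have Gu: "G ?u = node_vec i (r i) - node_vec i (l - 1)"
      using G[OF i, of "r i - l + 1"] l by simp
    have g: "(\<lambda>w. unit_vec (i, r i) w - unit_vec (i, l - 1) w) = Poly_Mapping.lookup (G ?u)"
      by (rule ext) (simp only: Gu lookup_minus unit_vec_eq_lookup)
    have "{w. Poly_Mapping.lookup (G ?u) w \<noteq> 0} = Poly_Mapping.keys (G ?u)"
      by (auto simp: in_keys_iff)
    moreover have "Poly_Mapping.keys (G ?u) \<subseteq> qverts (HL_quiver X)"
      unfolding Gu using i
      by (auto simp: in_keys_iff lookup_minus lookup_node_vec qverts_HL_quiver of_bool_def
          split: if_splits)
    moreover have "cluster_variable (HL_quiver X) ws ?u = laurent_monomial (G ?u) *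
        substitute (y_var (HL_quiver X)) (F_polynomial (HL_quiver X) ws ?u)"
      unfolding HL.seed_dataD(5)[OF data]
      by (simp add: HL.specialize_def HL.framed_variable_def F_polynomial_def)
    ultimately have "is_g_vector (HL_quiver X) ws ?u (\<lambda>w. unit_vec (i, r i) w - unit_vec (i, l - 1) w)"
      unfolding g is_g_vector_def by (simp add: laurent_monomial_def)
    then show ?thesis
      unfolding corresponds_def using i l
      by (intro bexI[of _ i] exI[of _ "l - 1"] exI[of _ "r i - l + 1"]) auto
  qed
  then show ?thesis
    using HL.seed_dataD(1)[OF data]
    by (intro exI[of _ ws] conjI ballI bexI[of _ "(_, r _ - _ + 1)"]) (auto simp: qverts_HL_quiver)
qed

end

theorem theorem7p10:
  fixes X :: dynkin_type and m :: nat and l r :: "nat \<Rightarrow> nat"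
  assumes "valid_type X"
    and "real m \<ge> real (coxeter_number X) / 2 + 1"
    and "\<forall>i\<in>{1..type_rank X}. real (l i) \<ge> real (coxeter_number X) / 2"
    and "\<forall>i\<in>{1..type_rank X}. r i = right_endpoint X m i"
    and "\<forall>i\<in>{1..type_rank X}. {l i..r i} \<noteq> {}"
  shows "\<exists>\<S>. green_sequence (HL_quiver X) \<S> \<and>
           (\<forall>i\<in>{1..type_rank X}. \<exists>u\<in>qverts (HL_quiver X).
              corresponds X \<S> u (KR X i (r i - l i + 1) (r i)))"
proof -
  interpret dynkin_slice X r
  proof
    fix i j
    assume "(i, j) \<in> dynkin_arrows X"
    then show "r j \<le> r i \<and> r i \<le> r j + 1"
      using right_endpoint_slice[OF assms(1)] dynkin_arrows_range[OF assms(1)] assms(4) by simp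
  qed (rule assms(1))
  \<comment> \<open>A positive Coxeter number forces \<open>l i \<ge> 1\<close>, so supports start
    at a genuine index.\<close>
  have "coxeter_number X > 0"
    using assms(1) by (cases X) auto
  then have "l i \<in> {1..r i}" if "i \<in> {1..type_rank X}" for i
    using assms(3,5) that by (cases "l i") force+
  then show ?thesis
    using exists_green_sequence by blast
qed

end
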